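(* Let $L=\{\ell_1,\ell_2,\ldots\}$ be an infinite (strictly) increasing sequence of odd integers, with $\ell_1\ge 3$. Then $$w_{L}(\varepsilon)=\mathrm{poly}(1/\varepsilon) \quad\text{if and only if}\quad \limsup_{j \to \infty}{\frac{\log \ell_{j+1}}{\log \ell_j}} < \infty.$$
   Context: Graphs are finite and simple. A graph is $L$-free if it contains no copy of the cycle $C_\ell$ (as a not necessarily induced subgraph) for every $\ell\in L$. An $n$-vertex graph $G$ is $\varepsilon$-far from being $L$-free if one must remove at least $\varepsilon n^2$ edges from $G$ to make it $L$-free. For $\varepsilon\in(0,1)$, $w_L(\varepsilon)$ is the smallest positive integer $w$ such that for every sufficiently large graph $G$ which is $\varepsilon$-far from being $L$-free, a uniformly random set $S$ of $w$ vertices of $G$ is such that $G[S]$ is not $L$-free with probability at least $2/3$. (It is a known fact that $w_L(\varepsilon)$ is well-defined.) The notation $w_L(\varepsilon)=\mathrm{poly}(1/\varepsilon)$ means that there is a constant $C$ (which may depend on $L$) with $w_L(\varepsilon)\le C\varepsilon^{-C}$ for all $\varepsilon\in(0,1)$. *)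

theory Defs
  imports "HOL-Probability.Probability"
begin

type_synonym 'a sgraph = "'a set \<times> 'a set set"

abbreviation verts :: "'a sgraph \<Rightarrow> 'a set" where
  "verts G \<equiv> fst G"

abbreviation edges :: "'a sgraph \<Rightarrow> 'a set set" where
  "edges G \<equiv> snd G"

definition finite_simple_graph :: "'a sgraph \<Rightarrow> bool" where
  "finite_simple_graph G \<longleftrightarrow>
     finite (verts G) \<and> edges G \<subseteq> {e. e \<subseteq> verts G \<and> card e = 2}"

definition induced_subgraph :: "'a sgraph \<Rightarrow> 'a set \<Rightarrow> 'a sgraph" where
  "induced_subgraph G S = (verts G \<inter> S, {e \<in> edges G. e \<subseteq> S})"

definition remove_edges :: "'a sgraph \<Rightarrow> 'a set set \<Rightarrow> 'a sgraph" where
  "remove_edges G F = (verts G, edges G - F)"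

definition contains_copy :: "'b sgraph \<Rightarrow> 'a sgraph \<Rightarrow> bool" where
  "contains_copy H G \<longleftrightarrow>
     (\<exists>f. inj_on f (verts H) \<and> f ` verts H \<subseteq> verts G \<and> (\<forall>e\<in>edges H. f ` e \<in> edges G))"

(* The cycle of length l on the vertices 0, ..., l - 1; meaningful only for l \<ge> 3. *)
definition cycle_graph :: "nat \<Rightarrow> nat sgraph" where
  "cycle_graph l = ({..<l}, {{i, (i + 1) mod l} | i. i < l})"

definition cycles_free :: "nat set \<Rightarrow> 'a sgraph \<Rightarrow> bool" where
  "cycles_free L G \<longleftrightarrow> (\<forall>l\<in>L. \<not> contains_copy (cycle_graph l) G)"

definition far_from_cycles_free :: "real \<Rightarrow> nat set \<Rightarrow> 'a sgraph \<Rightarrow> bool" where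
  "far_from_cycles_free \<epsilon> L G \<longleftrightarrow>
     (\<forall>F \<subseteq> edges G. cycles_free L (remove_edges G F) \<longrightarrow>
        real (card F) \<ge> \<epsilon> * real (card (verts G)) ^ 2)"

definition random_vertex_set :: "'a sgraph \<Rightarrow> nat \<Rightarrow> 'a set pmf" where
  "random_vertex_set G w = pmf_of_set {S. S \<subseteq> verts G \<and> card S = w}"

(* Vertices are natural numbers without loss of generality, since every finite graph is
   isomorphic to one on a finite set of naturals.  The threshold N may depend on w, so graphs
   with fewer than w vertices (for which the random vertex set is unspecified) play no role. *)
definition sample_size_suffices :: "nat set \<Rightarrow> real \<Rightarrow> nat \<Rightarrow> bool" where
  "sample_size_suffices L \<epsilon> w \<longleftrightarrow>
     (\<exists>N. \<forall>G :: nat sgraph.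
        finite_simple_graph G \<and> card (verts G) \<ge> N \<and> far_from_cycles_free \<epsilon> L G \<longrightarrow>
        measure_pmf.prob (random_vertex_set G w)
          {S. \<not> cycles_free L (induced_subgraph G S)} \<ge> 2 / 3)"

(* The least sufficient positive sample size.  It always exists, by a removal-lemma argument;
   taking the infimum in enat means that the definition does not rely on this fact (the
   value would be \<infinity> if no sample size sufficed). *)
definition sample_complexity :: "nat set \<Rightarrow> real \<Rightarrow> enat" where
  "sample_complexity L \<epsilon> = (INF w \<in> {w. w > 0 \<and> sample_size_suffices L \<epsilon> w}. enat w)"

definition poly_sample_complexity :: "nat set \<Rightarrow> bool" where
  "poly_sample_complexity L \<longleftrightarrow>
     (\<exists>C :: real. \<forall>\<epsilon> \<in> {0<..<1}.
        ereal_of_enat (sample_complexity L \<epsilon>) \<le> ereal (C * \<epsilon> powr (- C)))"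

end

(* If the gaps are superpolynomial, let k = l j + 2 and let m be the next element of L.  The blow-up
   of the cycle of length k is 1/O(k^2)-far from being L-free, because it contains cycles of length m
   robustly, but it has no shorter cycles with length in L, so a sample needs m vertices.

   For the converse, a graph that is far from L-free is far from bipartite.  A random sample of
   poly(1/eps) vertices is then not 2-colourable (the colouring of a small sample forces the colours of
   almost all other vertices), and averaging over the small subsets of a larger random sample shows that
   the latter is still far from bipartite.  A graph on q vertices that is far from bipartite contains
   cycles of every odd length between poly(1/eps) and poly(eps) q: it has a large subset in which every
   cut is dense, so that short paths of prescribed parity between two vertices can avoid any small set;
   such a path from u to p is closed up by a path starting in p with every second vertex adjacent to u,
   which can be cut off at any even length.  Polynomial gaps put an element of L in this range. *)
theory Submission
  imports Defs
begin

section \<open>Walks and cycles\<close>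

text \<open>Both directions rest on \<open>cycle_of_length_if_far_bipartite\<close>. For bounded
  gaps it is applied to a large random sample. For superpolynomial gaps it is applied to the blow-up
  with few edges removed, which is what robust containment amounts to. There it needs
  \<open>m\<close> to be at least 216 k^2; below that bound the gap is polynomial anyway. The number
  \<open>l j + 2\<close> is the least odd number above \<open>l j\<close>, so the blow-up has no odd
  cycle of length at most \<open>l j\<close>. The obstacle in the converse is that a sample which is
  merely not bipartite yields some odd cycle, whose length may be missing from \<open>L\<close>. To
  reach a prescribed length the sample must itself be quantitatively far from bipartite, with only
  polynomial loss; hence the second sampling step. Distance from bipartiteness is expressed by
  \<open>mono_pairs\<close> and a natural number \<open>K\<close> in the place of 1/eps, so that
  most estimates are inequalities between natural numbers.\<close>

lemma successively_through:
  "successively P (xs @ y # ys) \<longleftrightarrow> successively P (xs @ [y]) \<and> successively P (y # ys)"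
  by (cases ys) (auto simp: successively_append_iff)

locale adjacency =
  fixes adj :: "'a \<Rightarrow> 'a \<Rightarrow> bool"
  assumes adj_sym: "adj u v \<Longrightarrow> adj v u"
    and adj_irrefl: "\<not> adj u u"
begin

text \<open>A walk is the list of its vertices, so \<open>length xs\<close> exceeds the number of
  steps by one, and a path of even length is a list of odd length.\<close>

definition walk :: "'a set \<Rightarrow> 'a \<Rightarrow> 'a \<Rightarrow> 'a list \<Rightarrow> bool" where
  "walk S u v xs \<longleftrightarrow>
     xs \<noteq> [] \<and> hd xs = u \<and> last xs = v \<and> set xs \<subseteq> S \<and> successively adj xs"

text \<open>A list of two vertices can satisfy this, but by irreflexivity an odd
  \<open>cyclic\<close> list without repetitions has at least three entries, so it is a genuine
  cycle.\<close>

definition cyclic :: "'a list \<Rightarrow> bool" where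
  "cyclic xs \<longleftrightarrow> xs \<noteq> [] \<and> successively adj xs \<and> adj (last xs) (hd xs)"

text \<open>The pairs are ordered, so every monochromatic edge is counted twice. The minimum over
  all \<open>c\<close> is twice the least number of edges whose removal makes the graph on
  \<open>W\<close> bipartite.\<close>

definition mono_pairs :: "('a \<Rightarrow> bool) \<Rightarrow> 'a set \<Rightarrow> ('a \<times> 'a) set" where
  "mono_pairs c W = {(u, v). u \<in> W \<and> v \<in> W \<and> adj u v \<and> c u = c v}"

definition crossing :: "'a set \<Rightarrow> 'a set \<Rightarrow> ('a \<times> 'a) set" where
  "crossing A B = {(u, v). u \<in> A \<and> v \<in> B \<and> adj u v}"

lemma successively_adj_rev: "successively adj xs \<Longrightarrow> successively adj (rev xs)"
  unfolding successively_rev by (erule successively_mono) (auto intro: adj_sym)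

lemma walk_rev: "walk S u v xs \<Longrightarrow> walk S v u (rev xs)"
  using successively_adj_rev[of xs]
  by (auto simp: walk_def hd_rev last_rev simp del: successively_rev)

lemma walk_snoc:
  assumes "walk S u v xs" "adj v w" "w \<in> S"
  shows "walk S u w (xs @ [w])"
  using assms by (auto simp: walk_def successively_append_iff)

lemma walk_join:
  assumes "walk S u v xs" "walk S v w ys"
  shows "walk S u w (xs @ tl ys)"
proof -
  obtain y zs where "ys = y # zs" using assms(2) by (cases ys) (auto simp: walk_def)
  then show ?thesis
    using assms by (cases zs) (auto simp: walk_def successively_append_iff)
qed

text \<open>Cutting out the stretch between two occurrences of a vertex shortens the walk but may
  change its parity; this is why paths of prescribed parity need a separate argument.\<close>

lemma walk_distinct:
  assumes "walk S u v xs"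
  shows "\<exists>ys. walk S u v ys \<and> distinct ys \<and> length ys \<le> length xs"
  using assms
proof (induction "length xs" arbitrary: xs rule: less_induct)
  case less
  show ?case
  proof (cases "distinct xs")
    case True
    then show ?thesis using less.prems by blast
  next
    case False
    then obtain as bs cs y where xs: "xs = as @ [y] @ bs @ [y] @ cs"
      using not_distinct_decomp by blast
    have "successively adj (as @ y # bs @ y # cs)"
      using less.prems by (simp add: xs walk_def)
    then have "successively adj (as @ [y])" "successively adj (y # cs)"
      using successively_through[of adj as y "bs @ y # cs"] successively_through[of adj "y # bs" y cs]
      by auto
    then have "successively adj (as @ [y] @ cs)"
      using successively_through[of adj as y cs] by simp
    then have "walk S u v (as @ [y] @ cs)"
      using less.prems unfolding xs walk_def by (cases as; cases cs) auto
    then show ?thesis using less.hyps[of "as @ [y] @ cs"] by (force simp: xs)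
  qed
qed

lemma cyclic_rotate: "cyclic (xs @ ys) \<Longrightarrow> cyclic (ys @ xs)"
  by (cases "xs = []"; cases "ys = []") (auto simp: cyclic_def successively_append_iff)

text \<open>The start is listed again at the end, so an even list has an odd number of steps. A
  further repetition splits the walk into two shorter closed walks whose numbers of steps have an
  odd sum, and one of them is odd.\<close>

lemma closed_walk_odd_cycle:
  assumes "successively adj zs" "zs \<noteq> []" "hd zs = last zs" "even (length zs)"
  shows "\<exists>cs. cyclic cs \<and> distinct cs \<and> odd (length cs) \<and> set cs \<subseteq> set zs \<and> length cs < length zs"
  using assms
proof (induction "length zs" arbitrary: zs rule: less_induct)
  case less
  obtain z ys where zs: "zs = z # ys" using less.prems by (cases zs) auto
  have ys: "ys \<noteq> []" "last ys = z" "adj z (hd ys)" "successively adj ys" "odd (length ys)"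
    using less.prems zs by (auto simp: successively_Cons split: if_splits)
  show ?case
  proof (cases "distinct ys")
    case True
    then show ?thesis using ys by (intro exI[of _ ys]) (auto simp: cyclic_def zs)
  next
    case False
    then obtain as bs cs y where d: "ys = as @ [y] @ bs @ [y] @ cs"
      using not_distinct_decomp by blast
    let ?p = "[y] @ bs @ [y]" and ?q = "z # as @ [y] @ cs"
    have sub: "set ?p \<subseteq> set zs" "set ?q \<subseteq> set zs" "length ?p < length zs" "length ?q < length zs"
      by (auto simp: zs d)
    have s: "successively adj (z # as @ y # bs @ y # cs)"
      using less.prems(1) by (simp add: zs d)
    have p: "successively adj ?p" and "successively adj ((z # as) @ [y])" "successively adj (y # cs)"
      using s successively_through[of adj "z # as" y "bs @ y # cs"]
        successively_through[of adj "y # bs" y cs] by auto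
    then have q: "successively adj ?q"
      using successively_through[of adj "z # as" y cs] by simp
    have ql: "hd ?q = last ?q" using ys(2) by (cases cs) (auto simp: d)
    have "even (length ?p) \<or> even (length ?q)"
      using ys(5) by (auto simp: d)
    then show ?thesis
    proof
      assume "even (length ?p)"
      then show ?thesis using less.hyps[OF sub(3) p] sub by force
    next
      assume "even (length ?q)"
      then show ?thesis using less.hyps[OF sub(4) q _ ql] sub
        by (metis (no_types, lifting) less_trans list.distinct(1) subset_trans)
    qed
  qed
qed

text \<open>Stopping a path at its first vertex in \<open>C\<close> lets it be attached to a cycle
  with vertex set \<open>C\<close> without meeting that cycle elsewhere.\<close>

lemma walk_first_in:
  assumes "walk S u v xs" "distinct xs" "v \<in> C" "u \<notin> C"
  shows "\<exists>ys c. walk S u c (ys @ [c]) \<and> distinct (ys @ [c]) \<and> c \<in> C \<and> set ys \<inter> C = {} \<and> ys \<noteq> [] \<and>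
    length ys < length xs"
proof -
  have "\<exists>x\<in>set xs. x \<in> C" using assms by (metis walk_def last_in_set)
  then obtain ys c zs where xs: "xs = ys @ c # zs" "c \<in> C" "\<forall>y\<in>set ys. y \<notin> C"
    using split_list_first_prop[of xs "\<lambda>x. x \<in> C"] by blast
  have "ys \<noteq> []" using assms xs by (cases ys) (auto simp: walk_def)
  then show ?thesis using xs assms(1,2)
    by (intro exI[of _ ys] exI[of _ c]) (auto simp: walk_def successively_append_iff)
qed

text \<open>The two arcs of an odd cycle between two of its vertices have different parities.\<close>
lemma odd_cycle_arcs:
  assumes "cyclic cs" "distinct cs" "odd (length cs)" "a \<in> set cs" "b \<in> set cs" "a \<noteq> b"
  shows "\<exists>ys. distinct (a # ys @ [b]) \<and> successively adj (a # ys @ [b]) \<and>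
    set (a # ys @ [b]) \<subseteq> set cs \<and> (even (length ys) \<longleftrightarrow> e) \<and> length ys + 2 \<le> length cs"
proof -
  obtain ps qs where "cs = ps @ a # qs" using assms(4) by (meson split_list)
  moreover define ds where "ds = qs @ ps"
  ultimately have ds: "cyclic (a # ds)" "distinct (a # ds)" "set (a # ds) = set cs"
      "length (a # ds) = length cs"
    using cyclic_rotate[of ps "a # qs"] assms by auto
  then have "b \<in> set ds" using assms by auto
  then obtain ys zs where d: "ds = ys @ b # zs" by (meson split_list)
  have len: "length ys + length zs + 2 = length cs" using ds(4) d by simp
  have 1: "successively adj (a # ys @ [b])"
    using ds(1) successively_through[of adj "a # ys" b zs] by (simp add: cyclic_def d)
  have "successively adj (b # zs)" "adj (last (b # zs)) a"
    using ds(1) successively_through[of adj "a # ys" b zs] by (auto simp: cyclic_def d)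
  then have "successively adj (b # zs @ [a])"
    using successively_append_iff[of adj "b # zs" "[a]"] by simp
  then have 2: "successively adj (a # rev zs @ [b])"
    using successively_adj_rev[of "b # zs @ [a]"] by simp
  show ?thesis
  proof (cases "even (length ys) \<longleftrightarrow> e")
    case True
    then show ?thesis using 1 ds(2,3) len by (intro exI[of _ ys]) (auto simp: d)
  next
    case False
    then have "even (length (rev zs)) \<longleftrightarrow> e" using len assms(3) by (metis even_add even_two_times_div_two length_rev odd_two_times_div_two_succ dvd_refl)
    then show ?thesis using 2 ds(2,3) len by (intro exI[of _ "rev zs"]) (auto simp: d)
  qed
qed

end

section \<open>Expanding subgraphs of graphs far from bipartite\<close>

context adjacency
begin

lemma mono_pairs_subset: "mono_pairs c W \<subseteq> W \<times> W"
  by (auto simp: mono_pairs_def)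

lemma crossing_subset: "crossing A B \<subseteq> A \<times> B"
  by (auto simp: crossing_def)

lemma finite_mono_pairs: "finite W \<Longrightarrow> finite (mono_pairs c W)"
  using mono_pairs_subset by (rule finite_subset) simp

lemma finite_crossing: "finite A \<Longrightarrow> finite B \<Longrightarrow> finite (crossing A B)"
  using crossing_subset by (rule finite_subset) simp

lemma card_mono_pairs_Un:
  assumes "finite A" "finite B" "A \<inter> B = {}"
  shows "card (mono_pairs c (A \<union> B)) = card (mono_pairs c A) + card (mono_pairs c B) +
    2 * card {(u, v) \<in> crossing A B. c u = c v}"
proof -
  let ?X = "{(u, v) \<in> crossing A B. c u = c v}"
  have fX: "finite ?X" by (rule finite_subset[OF _ finite_crossing[OF assms(1,2)]]) auto
  have "mono_pairs c (A \<union> B) = (mono_pairs c A \<union> mono_pairs c B) \<union> (?X \<union> prod.swap ` ?X)"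
    by (auto simp: mono_pairs_def crossing_def image_iff intro: adj_sym)
  moreover have "card (mono_pairs c A \<union> mono_pairs c B) = card (mono_pairs c A) + card (mono_pairs c B)"
    using assms by (intro card_Un_disjoint finite_mono_pairs) (auto simp: mono_pairs_def)
  moreover have "card (?X \<union> prod.swap ` ?X) = card ?X + card (prod.swap ` ?X)"
    using assms fX by (intro card_Un_disjoint) (auto simp: crossing_def)
  moreover have "card (prod.swap ` ?X) = card ?X"
    by (rule card_image) (auto simp: inj_on_def)
  moreover have "card ((mono_pairs c A \<union> mono_pairs c B) \<union> (?X \<union> prod.swap ` ?X)) =
      card (mono_pairs c A \<union> mono_pairs c B) + card (?X \<union> prod.swap ` ?X)"
    using assms fX
    by (intro card_Un_disjoint) (auto simp: mono_pairs_def crossing_def intro: finite_mono_pairs[unfolded mono_pairs_def])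
  ultimately show ?thesis by simp
qed

text \<open>Among the two ways of gluing colourings of the parts, one makes at least half of
  the crossing pairs bichromatic.\<close>
lemma mono_pairs_glue:
  assumes "finite A" "finite B" "A \<inter> B = {}"
  shows "\<exists>c. card (mono_pairs c (A \<union> B)) \<le>
    card (mono_pairs cA A) + card (mono_pairs cB B) + card (crossing A B)"
proof -
  \<comment> \<open>The value \<open>True\<close> of \<open>s\<close> flips the colours on
    \<open>B\<close>. Every crossing pair is monochromatic for exactly one of the two
    values.\<close>
  define c where "c s x = (if x \<in> A then cA x else (cB x \<noteq> s))" for s x
  have A: "mono_pairs (c s) A = mono_pairs cA A" for s by (auto simp: mono_pairs_def c_def)
  have "c s u = c s v \<longleftrightarrow> cB u = cB v" if "u \<in> B" "v \<in> B" for s u v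
    using assms(3) that by (auto simp: c_def)
  then have B: "mono_pairs (c s) B = mono_pairs cB B" for s
    unfolding mono_pairs_def by blast
  let ?X = "\<lambda>s. {(u, v) \<in> crossing A B. c s u = c s v}"
  have X: "crossing A B = ?X True \<union> ?X False" "?X True \<inter> ?X False = {}"
    using assms(3) by (auto simp: crossing_def c_def)
  have "finite (?X s)" for s
    by (rule finite_subset[OF _ finite_crossing[OF assms(1,2)]]) auto
  then have "card (crossing A B) = card (?X True) + card (?X False)"
    using card_Un_disjoint[of "?X True" "?X False"] X by simp
  then have "2 * card (?X True) \<le> card (crossing A B) \<or> 2 * card (?X False) \<le> card (crossing A B)"
    by linarith
  then obtain s where "2 * card (?X s) \<le> card (crossing A B)" by blast
  then show ?thesis
    using card_mono_pairs_Un[OF assms, of "c s"] A[of s] B[of s] by (intro exI[of _ "c s"]) simp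
qed

text \<open>If a minimal good set is split into \<open>A\<close> and the rest, neither part is good,
  so both have colourings with few monochromatic pairs. Gluing these loses at most the crossing
  pairs, which therefore make up for the superadditivity of \<open>f\<close>: f(a + b) - f(a) - f(b)
  = ab/K.\<close>

lemma expander_subset:
  fixes K :: nat
  assumes V: "finite V" "V \<noteq> {}" and K: "K > 0"
    and far: "\<And>c. card (mono_pairs c V) * K \<ge> (card V)\<^sup>2"
  shows "\<exists>W. W \<subseteq> V \<and> W \<noteq> {} \<and> card W * (2 * K) \<ge> card V \<and>
    (\<forall>c. card (mono_pairs c W) * K \<ge> (card W)\<^sup>2) \<and>
    (\<forall>A. A \<subseteq> W \<longrightarrow> A \<noteq> {} \<longrightarrow> A \<noteq> W \<longrightarrow> card (crossing A (W - A)) * K \<ge> card A * card (W - A))"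
proof -
  \<comment> \<open>The linear term forces a minimal good set to be large, the quadratic one makes it expand.\<close>
  define f where "f x = (x * card V + x\<^sup>2) / (2 * K)" for x :: real
  define good where "good W \<longleftrightarrow> W \<subseteq> V \<and> W \<noteq> {} \<and> (\<forall>c. card (mono_pairs c W) \<ge> f (card W))" for W
  have "f (card V) \<le> card (mono_pairs c V)" for c
    using of_nat_mono[OF far[of c], where 'a = real] K
    by (simp add: f_def field_simps power2_eq_square)
  then have "good V" using V by (auto simp: good_def)
  then obtain W where W: "good W" and min: "\<And>A. good A \<Longrightarrow> card W \<le> card A"
    using arg_min_natI[of good V card] arg_min_nat_le[of good _ card] by metis
  have fW: "finite W" using W V(1) by (auto simp: good_def intro: finite_subset)
  have le: "card W \<le> card V" using W V(1) by (auto simp: good_def intro: card_mono)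
  have pos: "card W > 0" using W fW by (auto simp: good_def card_gt_0_iff)
  \<comment> \<open>A constant colouring has at most |W|^2 monochromatic pairs; compared with the
    linear term of \<open>f\<close> this bounds |W| from below.\<close>
  have "f (card W) \<le> card (mono_pairs (\<lambda>_. True) W)" using W by (auto simp: good_def)
  also have "\<dots> \<le> (card W)\<^sup>2"
    using card_mono[OF _ mono_pairs_subset, of W "\<lambda>_. True"] fW
    by (simp add: card_cartesian_product power2_eq_square flip: of_nat_mult)
  finally have "real (card W * (card V + card W)) \<le> real (card W * (card W * (2 * K)))"
    using K by (simp add: f_def field_simps power2_eq_square)
  then have size: "card V + card W \<le> card W * (2 * K)"
    unfolding of_nat_le_iff using pos by simp
  have mono: "real (card (mono_pairs c W)) * K \<ge> (card W)\<^sup>2" for c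
  proof -
    have "real (card W) * (card V + card W) \<le> real (card (mono_pairs c W)) * (2 * K)"
      using W K by (auto simp: good_def f_def field_simps power2_eq_square)
    moreover have "card W * (2 * card W) \<le> card W * (card V + card W)"
      using le by (intro mult_left_mono) auto
    then have "real (card W * (2 * card W)) \<le> real (card W * (card V + card W))"
      by (rule of_nat_mono)
    ultimately show ?thesis by (simp add: power2_eq_square)
  qed
  have cross: "real (card (crossing A (W - A))) * K \<ge> real (card A) * card (W - A)"
    if A: "A \<subseteq> W" "A \<noteq> {}" "A \<noteq> W" for A
  proof -
    let ?B = "W - A"
    have fin: "finite A" "finite ?B" using fW A by (auto intro: finite_subset)
    have W_eq: "A \<union> ?B = W" using A by auto
    have card: "card W = card A + card ?B"
      using card_Un_disjoint[OF fin] W_eq by auto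
    have "card A < card W" "card ?B < card W"
      using A fW by (auto intro!: psubset_card_mono)
    then have "\<not> good A" "\<not> good ?B" using min by (auto simp: not_le[symmetric])
    then obtain cA cB where c: "card (mono_pairs cA A) < f (card A)" "card (mono_pairs cB ?B) < f (card ?B)"
      using A W unfolding good_def by (metis Diff_eq_empty_iff Diff_subset not_le order.trans subset_antisym)
    obtain c where "card (mono_pairs c W) \<le>
        card (mono_pairs cA A) + card (mono_pairs cB ?B) + card (crossing A ?B)"
      using mono_pairs_glue[OF fin] W_eq by (metis Diff_disjoint)
    moreover have "f (card W) \<le> card (mono_pairs c W)" using W by (auto simp: good_def)
    ultimately have "f (card W) - f (card A) - f (card ?B) \<le> card (crossing A ?B)"
      using c by linarith
    moreover have "f (card W) - f (card A) - f (card ?B) = real (card A) * card ?B / K"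
      using K by (simp add: f_def card field_simps power2_eq_square)
    ultimately have "real (card A) * card ?B / K \<le> card (crossing A ?B)" by simp
    then show ?thesis using K by (simp add: pos_divide_le_eq)
  qed
  have "W \<subseteq> V" "W \<noteq> {}" using W by (auto simp: good_def)
  moreover have "card V \<le> card W * (2 * K)" using size by simp
  moreover have "(card W)\<^sup>2 \<le> card (mono_pairs c W) * K" for c
  proof -
    have "real ((card W)\<^sup>2) \<le> real (card (mono_pairs c W) * K)" using mono by simp
    then show ?thesis by (simp only: of_nat_le_iff)
  qed
  moreover have "card A * card (W - A) \<le> card (crossing A (W - A)) * K"
    if "A \<subseteq> W" "A \<noteq> {}" "A \<noteq> W" for A
  proof -
    have "real (card A * card (W - A)) \<le> real (card (crossing A (W - A)) * K)"
      using cross[OF that] by simp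
    then show ?thesis by (simp only: of_nat_le_iff)
  qed
  ultimately show ?thesis by blast
qed

end

section \<open>Short paths and odd cycles avoiding a small set\<close>

locale expander = adjacency adj for adj :: "'a \<Rightarrow> 'a \<Rightarrow> bool" +
  fixes W :: "'a set" and K :: nat
  assumes finite_W: "finite W" and W_nonempty: "W \<noteq> {}"
    and mono_W: "(card W)\<^sup>2 \<le> card (mono_pairs c W) * K"
    and crossing_W: "A \<subseteq> W \<Longrightarrow> A \<noteq> {} \<Longrightarrow> A \<noteq> W \<Longrightarrow>
      card A * card (W - A) \<le> card (crossing A (W - A)) * K"
begin

lemma card_W_pos: "card W > 0"
  using finite_W W_nonempty by (simp add: card_gt_0_iff)

lemma K_pos: "K > 0"
  using mono_W[of "\<lambda>_. True"] card_W_pos by (cases K) auto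

text \<open>This is expansion of the set \<open>{u}\<close>; the factor 2 absorbs the difference
  between \<open>card W - 1\<close> and \<open>card W\<close>.\<close>

lemma degree_W:
  assumes "u \<in> W" "card W \<ge> 2"
  shows "card W \<le> 2 * K * card {v \<in> W. adj u v}"
proof -
  have "crossing {u} (W - {u}) = Pair u ` {v \<in> W. adj u v}"
    using adj_irrefl by (auto simp: crossing_def)
  then have "card (crossing {u} (W - {u})) = card {v \<in> W. adj u v}"
    by (simp add: card_image inj_on_def)
  moreover have "W \<noteq> {u}" using assms(2) by auto
  ultimately have "card W - 1 \<le> card {v \<in> W. adj u v} * K"
    using crossing_W[of "{u}"] assms finite_W by auto
  then show ?thesis using assms(2) by (simp add: mult.commute mult.left_commute)
qed

text \<open>\<open>X\<close> is a forbidden set. The bound is \<open>r + 1\<close> because a list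
  with that many vertices makes \<open>r\<close> steps.\<close>

definition ball :: "'a set \<Rightarrow> 'a \<Rightarrow> nat \<Rightarrow> 'a set" where
  "ball X u r = {v. \<exists>xs. walk (W - X) u v xs \<and> length xs \<le> r + 1}"

lemma ball_subset: "ball X u r \<subseteq> W - X"
  unfolding ball_def walk_def by (auto dest: last_in_set)

lemma finite_ball: "finite (ball X u r)"
  using ball_subset finite_W by (meson finite_Diff finite_subset)

lemma ball_mono: "ball X u r \<subseteq> ball X u (Suc r)"
  unfolding ball_def using le_Suc_eq by auto

lemma center_in_ball: "u \<in> W - X \<Longrightarrow> u \<in> ball X u r"
  unfolding ball_def by (auto intro!: exI[of _ "[u]"] simp: walk_def)

text \<open>Edges leaving the ball end in the next ball or in \<open>X\<close>. Expansion requires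
  at least |W|/(2K) end vertices, of which \<open>X\<close> supplies at most |W|/(4K), so at least
  |W|/(4K) vertices are new.\<close>

lemma ball_grows:
  assumes X: "X \<subseteq> W" "4 * K * card X \<le> card W" and u: "u \<in> W - X"
    and small: "2 * card (ball X u r) \<le> card W"
  shows "4 * K * card (ball X u r) + card W \<le> 4 * K * card (ball X u (Suc r))"
proof -
  let ?B = "ball X u r" and ?C = "ball X u (Suc r)"
  have B: "?B \<subseteq> W" "?B \<noteq> {}" using ball_subset center_in_ball[OF u] by blast+
  have pos: "card ?B > 0" using B finite_ball by (simp add: card_gt_0_iff)
  have "?B \<noteq> W" using small card_W_pos by auto
  then have expand: "card ?B * card (W - ?B) \<le> card (crossing ?B (W - ?B)) * K"
    using crossing_W B by blast
  have "crossing ?B (W - ?B) \<subseteq> ?B \<times> ((?C - ?B) \<union> X)"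
  proof
    fix e assume "e \<in> crossing ?B (W - ?B)"
    then obtain v w where e: "e = (v, w)" "v \<in> ?B" "w \<in> W - ?B" "adj v w"
      by (auto simp: crossing_def)
    obtain xs where xs: "walk (W - X) u v xs" "length xs \<le> r + 1"
      using e(2) by (auto simp: ball_def)
    have "w \<in> ?C" if "w \<notin> X"
      using walk_snoc[OF xs(1) e(4)] e(3) that xs(2) unfolding ball_def by force
    then show "e \<in> ?B \<times> ((?C - ?B) \<union> X)" using e by auto
  qed
  then have "card (crossing ?B (W - ?B)) \<le> card (?B \<times> ((?C - ?B) \<union> X))"
    using finite_ball finite_subset[OF X(1) finite_W] by (intro card_mono) auto
  also have "\<dots> \<le> card ?B * (card (?C - ?B) + card X)"
    by (simp add: card_cartesian_product card_Un_le)
  finally have "card ?B * card (W - ?B) \<le> card ?B * (card (?C - ?B) + card X) * K"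
    by (rule order.trans[OF expand mult_le_mono1])
  then have "card ?B * card (W - ?B) \<le> card ?B * ((card (?C - ?B) + card X) * K)"
    by (simp only: mult.assoc)
  then have "card (W - ?B) \<le> (card (?C - ?B) + card X) * K" using pos by simp
  moreover have "card (W - ?B) = card W - card ?B" using B finite_ball by (simp add: card_Diff_subset)
  moreover have "card ?C = card ?B + card (?C - ?B)"
    using card_Diff_subset[OF finite_ball ball_mono, of X u r] card_mono[OF finite_ball ball_mono, of X u r]
    by simp
  ultimately show ?thesis using X(2) small by (simp add: algebra_simps)
qed

text \<open>After 2K + 1 steps that each gain |W|/(4K) vertices, more than half of \<open>W\<close>
  is reached.\<close>

lemma ball_large:
  assumes X: "X \<subseteq> W" "4 * K * card X \<le> card W" and u: "u \<in> W - X"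
  shows "card W < 2 * card (ball X u (2 * K + 1))"
proof -
  have "card W < 2 * card (ball X u r) \<or> r * card W \<le> 4 * K * card (ball X u r)" for r
  proof (induction r)
    case (Suc r)
    have "card (ball X u r) \<le> card (ball X u (Suc r))"
      using ball_mono finite_ball by (rule card_mono[rotated])
    then show ?case using Suc ball_grows[OF assms, of r] by fastforce
  qed simp
  then have *: "card W < 2 * card (ball X u (2 * K + 1)) \<or>
      (2 * K + 1) * card W \<le> 4 * K * card (ball X u (2 * K + 1))"
    by blast
  show ?thesis
  proof (rule ccontr)
    assume "\<not> card W < 2 * card (ball X u (2 * K + 1))"
    then have "2 * card (ball X u (2 * K + 1)) \<le> card W" by simp
    then have "2 * K * (2 * card (ball X u (2 * K + 1))) \<le> 2 * K * card W"
      by (rule mult_le_mono2)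
    then have "4 * K * card (ball X u (2 * K + 1)) \<le> 2 * K * card W" by simp
    moreover have "(2 * K + 1) * card W = 2 * K * card W + card W" by simp
    ultimately show False using * \<open>\<not> card W < _\<close> card_W_pos by linarith
  qed
qed

text \<open>Two balls that each fill more than half of \<open>W\<close> meet. Joining lists of at
  most 2K + 2 vertices at a common end gives 4K + 3.\<close>

lemma connect:
  assumes X: "X \<subseteq> W" "4 * K * card X \<le> card W" and u: "u \<in> W - X" "p \<in> W - X"
  shows "\<exists>xs. walk (W - X) u p xs \<and> distinct xs \<and> length xs \<le> 4 * K + 3"
proof -
  let ?r = "2 * K + 1"
  have "ball X u ?r \<inter> ball X p ?r \<noteq> {}"
  proof
    assume "ball X u ?r \<inter> ball X p ?r = {}"
    then have "card (ball X u ?r) + card (ball X p ?r) = card (ball X u ?r \<union> ball X p ?r)"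
      using finite_ball by (simp add: card_Un_disjoint)
    also have "\<dots> \<le> card W" using ball_subset finite_W by (intro card_mono) auto
    finally show False
      using ball_large[OF X u(1)] ball_large[OF X u(2)] by linarith
  qed
  then obtain v xs ys where "walk (W - X) u v xs" "length xs \<le> ?r + 1"
      "walk (W - X) p v ys" "length ys \<le> ?r + 1"
    by (auto simp: ball_def)
  then have "walk (W - X) u p (xs @ tl (rev ys))" "length (xs @ tl (rev ys)) \<le> 4 * K + 3"
    using walk_join[OF _ walk_rev] by auto
  then show ?thesis using walk_distinct by (meson le_trans)
qed

text \<open>Colour every vertex by the parity of a path to it from a fixed root. Deleting
  \<open>X\<close> destroys at most 2|X||W| monochromatic pairs, which is less than the |W|^2/K that
  exist. A surviving pair and the two paths to its ends form a closed walk with an odd number of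
  steps.\<close>

lemma odd_cycle_avoiding:
  assumes X: "X \<subseteq> W" "4 * K * card X \<le> card W"
  shows "\<exists>cs. cyclic cs \<and> distinct cs \<and> odd (length cs) \<and> set cs \<subseteq> W - X \<and> length cs \<le> 8 * K + 5"
proof -
  have "X \<noteq> W" using X(2) card_W_pos K_pos by auto
  then obtain r where r: "r \<in> W - X" using X(1) by auto
  obtain path where path: "\<And>v. v \<in> W - X \<Longrightarrow> walk (W - X) r v (path v) \<and> length (path v) \<le> 4 * K + 3"
    using connect[OF X r] by metis
  define c where "c v = even (length (path v))" for v
  have "mono_pairs c (W - X) \<noteq> {}"
  proof
    assume "mono_pairs c (W - X) = {}"
    then have sub: "mono_pairs c W \<subseteq> X \<times> W \<union> W \<times> X" by (auto simp: mono_pairs_def)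
    have finX: "finite X" using X(1) finite_W finite_subset by auto
    have "card (mono_pairs c W) \<le> card (X \<times> W \<union> W \<times> X)"
      using sub finX finite_W by (intro card_mono) auto
    also have "\<dots> \<le> 2 * card X * card W"
      using card_Un_le[of "X \<times> W" "W \<times> X"] by (simp add: card_cartesian_product mult.commute)
    finally have "card (mono_pairs c W) * K \<le> 2 * card X * card W * K" by (rule mult_le_mono1)
    with mono_W[of c] have "card W * card W \<le> 2 * card X * card W * K"
      unfolding power2_eq_square by (rule order.trans)
    also have "\<dots> = card W * (2 * K * card X)" by simp
    finally have "card W * card W \<le> card W * (2 * K * card X)" .
    then show False using X(2) card_W_pos by simp
  qed
  then obtain u v where uv: "u \<in> W - X" "v \<in> W - X" "adj u v" "c u = c v"
    by (auto simp: mono_pairs_def)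
  let ?zs = "path u @ rev (path v)"
  have "successively adj ?zs" "?zs \<noteq> []" "hd ?zs = last ?zs" "set ?zs \<subseteq> W - X"
    using path[OF uv(1)] path[OF uv(2)] uv(3) successively_adj_rev[of "path v"]
    by (auto simp: walk_def successively_append_iff hd_rev last_rev simp del: successively_rev)
  moreover have "even (length ?zs)" using uv(4) by (auto simp: c_def)
  moreover have "length ?zs \<le> 8 * K + 6" using path[OF uv(1)] path[OF uv(2)] by auto
  ultimately show ?thesis
    using closed_walk_odd_cycle[of ?zs] by fastforce
qed

text \<open>Both endpoints are joined by disjoint paths to an odd cycle, which is then traversed in
  the direction of the right parity.\<close>
lemma even_path_avoiding:
  assumes X: "X \<subseteq> W" "4 * K * (card X + 4 * K + 5) \<le> card W"
    and u: "u \<in> W - X" "p \<in> W - X" "u \<noteq> p"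
  shows "\<exists>xs. walk (W - X) u p xs \<and> distinct xs \<and> odd (length xs) \<and> length xs \<le> 16 * K + 11"
proof -
  have fX: "finite X" using X(1) finite_W finite_subset by auto
  \<comment> \<open>Each set deleted below is \<open>X\<close> enlarged by one path or by at most
    two vertices, which the slack 4K + 5 covers.\<close>
  have small: "4 * K * card Y \<le> card W" if "card Y \<le> card X + 4 * K + 5" for Y :: "'a set"
    using X(2) that by (meson le_trans mult_le_mono2)
  have "card (X \<union> {u, p}) \<le> card X + 4 * K + 5"
    using card_Un_le[of X "{u, p}"] u(3) by simp
  then obtain cs where cs: "cyclic cs" "distinct cs" "odd (length cs)"
      "set cs \<subseteq> W - (X \<union> {u, p})" "length cs \<le> 8 * K + 5"
    using odd_cycle_avoiding[of "X \<union> {u, p}"] X(1) u small by auto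
  have "length cs \<noteq> 1" using cs(1) adj_irrefl by (auto simp: cyclic_def length_Suc_conv)
  then have "length cs \<ge> 2" using cs(3) by (cases "length cs") auto
  then obtain a b where ab: "a \<in> set cs" "b \<in> set cs" "a \<noteq> b"
    using cs(2) by (metis card_le_Suc0_iff_eq distinct_card finite_set not_less_eq_eq numeral_2_eq_2)
  have "card (X \<union> {p}) \<le> card X + 4 * K + 5"
    using card_Un_le[of X "{p}"] by simp
  then have "\<exists>xs. walk (W - (X \<union> {p})) u a xs \<and> distinct xs \<and> length xs \<le> 4 * K + 3"
    using cs(4) ab(1) u X(1) by (intro connect small) auto
  then obtain xs where xs: "walk (W - (X \<union> {p})) u a xs" "distinct xs" "length xs \<le> 4 * K + 3"
    by blast
  obtain as c where as: "walk (W - (X \<union> {p})) u c (as @ [c])" "distinct (as @ [c])" "c \<in> set cs"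
      "set as \<inter> set cs = {}" "as \<noteq> []" "length as < length xs"
    using walk_first_in[OF xs(1,2) ab(1)] u cs(4) by blast
  have asW: "set as \<union> {c} \<subseteq> W - (X \<union> {p})" "hd as = u" "u \<in> set as"
    using as(1,5) by (auto simp: walk_def)
  \<comment> \<open>The second path aims at another vertex of the cycle and avoids \<open>c\<close>,
    so it attaches at some \<open>d\<close> different from \<open>c\<close> and leaves two arcs to
    choose from.\<close>
  obtain c' where c': "c' \<in> set cs" "c' \<noteq> c" using ab by metis
  let ?Y = "X \<union> (set as \<union> {c})"
  have "card ?Y \<le> card X + card (set (as @ [c]))"
    using card_Un_le[of X "set as \<union> {c}"] by simp
  also have "card (set (as @ [c])) \<le> length (as @ [c])" by (rule card_length)
  finally have "card ?Y \<le> card X + 4 * K + 5" using as(6) xs(3) by simp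
  then have "\<exists>ys. walk (W - ?Y) p c' ys \<and> distinct ys \<and> length ys \<le> 4 * K + 3"
    using cs(4) c' u X(1) asW as(4) by (intro connect small) auto
  then obtain ys where ys: "walk (W - ?Y) p c' ys" "distinct ys" "length ys \<le> 4 * K + 3"
    by blast
  obtain bs d where bs: "walk (W - ?Y) p d (bs @ [d])" "distinct (bs @ [d])" "d \<in> set cs"
      "set bs \<inter> set cs = {}" "bs \<noteq> []" "length bs < length ys"
    using walk_first_in[OF ys(1,2) c'(1)] u cs(4) by blast
  have bsW: "set bs \<union> {d} \<subseteq> W - ?Y" "hd bs = p"
    using bs(1,5) by (auto simp: walk_def)
  have "c \<noteq> d" using bsW by auto
  then obtain zs where zs: "distinct (c # zs @ [d])" "successively adj (c # zs @ [d])"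
      "set (c # zs @ [d]) \<subseteq> set cs" "even (length zs) \<longleftrightarrow> odd (length as + length bs)"
      "length zs + 2 \<le> length cs"
    using odd_cycle_arcs[OF cs(1-3) as(3) bs(3), of "odd (length as + length bs)"] by auto
  let ?path = "as @ (c # zs @ [d]) @ rev bs"
  have "successively adj (rev (bs @ [d]))"
    using bs(1) successively_adj_rev unfolding walk_def by blast
  then have 1: "successively adj (d # rev bs)" by simp
  have "successively adj (as @ [c])" using as(1) by (simp add: walk_def)
  moreover have "successively adj ((c # zs) @ d # rev bs)"
    using zs(2) 1 successively_through[of adj "c # zs" d "rev bs"] by simp
  ultimately have "successively adj ?path"
    using successively_through[of adj as c "zs @ d # rev bs"] by simp
  then have "walk (W - X) u p ?path"
    using asW bsW zs(3) cs(4) as(5) bs(5) by (auto simp: walk_def last_rev)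
  moreover have "distinct ?path"
    using as(2,4) bs(2,4) zs(1,3) bsW(1) by auto
  moreover have "odd (length ?path)" using zs(4) by auto
  \<comment> \<open>An arc of at most 8K + 5 vertices and two connecting paths of at most 4K + 3
    each.\<close>
  moreover have "length ?path \<le> 16 * K + 11"
    using zs(5) cs(5) as(6) bs(6) xs(3) ys(3) by simp
  ultimately show ?thesis by blast
qed

end

section \<open>Subgraphs of large minimum degree and alternating paths\<close>

context adjacency
begin

lemma card_crossing_insert_left:
  assumes "finite A" "finite B" "x \<in> A"
  shows "card (crossing A B) = card (crossing (A - {x}) B) + card {y \<in> B. adj x y}"
proof -
  have "crossing A B = crossing (A - {x}) B \<union> Pair x ` {y \<in> B. adj x y}"
    using assms(3) by (auto simp: crossing_def)
  moreover have "card (crossing (A - {x}) B \<union> Pair x ` {y \<in> B. adj x y}) =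
      card (crossing (A - {x}) B) + card (Pair x ` {y \<in> B. adj x y})"
    using assms by (intro card_Un_disjoint finite_crossing) (auto simp: crossing_def)
  ultimately show ?thesis by (simp add: card_image inj_on_def)
qed

lemma card_crossing_commute: "card (crossing A B) = card (crossing B A)"
proof -
  have "crossing A B = prod.swap ` crossing B A"
    by (auto simp: crossing_def image_iff intro: adj_sym)
  also have "card \<dots> = card (crossing B A)" by (rule card_image) (auto simp: inj_on_def)
  finally show ?thesis .
qed

lemma crossing_ge:
  assumes "finite A" "finite B" "\<And>x. x \<in> A \<Longrightarrow> d \<le> k * card {y \<in> B. adj x y}"
  shows "card A * d \<le> k * card (crossing A B)"
  using assms(1,3)
proof (induction A rule: finite_induct)
  case (insert x A)
  then have "card (crossing (insert x A) B) = card (crossing A B) + card {y \<in> B. adj x y}"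
    using card_crossing_insert_left[of "insert x A" B x] assms(2) by simp
  moreover have "card A * d \<le> k * card (crossing A B)" using insert by simp
  moreover have "d \<le> k * card {y \<in> B. adj x y}" using insert.prems[of x] by simp
  ultimately show ?case using insert.hyps by (simp add: algebra_simps)
qed simp

text \<open>The pair is chosen to maximise the number of crossing pairs minus \<^term>\<open>d\<close> times the number
  of vertices: removing a vertex of small degree would increase this quantity.\<close>
lemma crossing_min_degree:
  assumes A: "finite A" and B: "finite B" and large: "d * (card A + card B) < card (crossing A B)"
  shows "\<exists>X Y. X \<subseteq> A \<and> Y \<subseteq> B \<and> X \<noteq> {} \<and> (\<forall>x\<in>X. d \<le> card {y \<in> Y. adj x y}) \<and>
    (\<forall>y\<in>Y. d \<le> card {x \<in> X. adj y x})"
proof -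
  define f where "f = (\<lambda>(X, Y). int d * (int (card X) + int (card Y)) - int (card (crossing X Y)))"
  let ?P = "Pow A \<times> Pow B"
  have "finite ?P" "?P \<noteq> {}" using A B by auto
  then obtain p where "is_arg_min f (\<lambda>p. p \<in> ?P) p" using ex_is_arg_min_if_finite by blast
  then obtain X Y where XY: "(X, Y) \<in> ?P" and min: "\<And>Z. Z \<in> ?P \<Longrightarrow> f (X, Y) \<le> f Z"
    unfolding is_arg_min_linorder by (metis surj_pair)
  have fin: "finite X" "finite Y" using XY A B by (auto intro: finite_subset)
  have "f (X, Y) \<le> f (A, B)" by (rule min) auto
  also have "\<dots> < 0" using large by (simp add: f_def flip: of_nat_add of_nat_mult)
  finally have neg: "f (X, Y) < 0" .
  have "X \<noteq> {}"
  proof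
    assume "X = {}"
    then have "crossing X Y = {}" by (auto simp: crossing_def)
    then have "f (X, Y) \<ge> 0" by (simp add: f_def)
    then show False using neg by simp
  qed
  moreover have "d \<le> card {y \<in> Y. adj x y}" if x: "x \<in> X" for x
  proof -
    have "f (X, Y) \<le> f (X - {x}, Y)" using XY by (intro min) auto
    moreover have "card X = card (X - {x}) + 1" using card_Suc_Diff1[OF fin(1) x] by simp
    ultimately show ?thesis
      using card_crossing_insert_left[OF fin x] by (simp add: f_def algebra_simps)
  qed
  moreover have "d \<le> card {x \<in> X. adj y x}" if y: "y \<in> Y" for y
  proof -
    have "f (X, Y) \<le> f (X, Y - {y})" using XY by (intro min) auto
    moreover have "card Y = card (Y - {y}) + 1" using card_Suc_Diff1[OF fin(2) y] by simp
    ultimately show ?thesis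
      using card_crossing_insert_left[OF fin(2,1) y] card_crossing_commute[of X Y]
        card_crossing_commute[of X "Y - {y}"]
      by (simp add: f_def algebra_simps)
  qed
  ultimately show ?thesis using XY by blast
qed

text \<open>The path is extended greedily: at most \<open>L + 1\<close> vertices are forbidden,
  namely those already used and \<open>u\<close>, and \<open>L + 2\<close> candidates exist. The
  sets \<open>X\<close> and \<open>Y\<close> may overlap and \<open>Y\<close> may contain
  \<open>u\<close>, so alternation alone would not prevent repetitions.\<close>

lemma alternating_path:
  assumes fin: "finite X" "finite Y" "X \<noteq> {}"
    and deg: "\<And>x. x \<in> X \<Longrightarrow> L + 2 \<le> card {y \<in> Y. adj x y}"
      "\<And>y. y \<in> Y \<Longrightarrow> L + 2 \<le> card {x \<in> X. adj y x}"
    and u: "u \<notin> X" and L: "k \<le> L"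
  shows "\<exists>ps. length ps = k + 1 \<and> distinct ps \<and> u \<notin> set ps \<and> successively adj ps \<and>
    (\<forall>i\<le>k. ps ! i \<in> (if even i then X else Y))"
  using L
proof (induction k)
  case 0
  obtain x where "x \<in> X" using fin by auto
  then show ?case using u by (intro exI[of _ "[x]"]) auto
next
  case (Suc k)
  then obtain ps where ps: "length ps = k + 1" "distinct ps" "u \<notin> set ps" "successively adj ps"
      "\<forall>i\<le>k. ps ! i \<in> (if even i then X else Y)" by auto
  let ?Z = "if even (Suc k) then X else Y"
  have last: "last ps = ps ! k" using ps(1) by (subst last_conv_nth) auto
  have "L + 2 \<le> card {z \<in> ?Z. adj (last ps) z}"
    using ps(5) deg last by (auto split: if_splits)
  moreover have "card (insert u (set ps)) \<le> L + 1"
    using ps(1) Suc.prems card_length[of "u # ps"] by simp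
  ultimately have "\<not> {z \<in> ?Z. adj (last ps) z} \<subseteq> insert u (set ps)"
    using card_mono[of "insert u (set ps)" "{z \<in> ?Z. adj (last ps) z}"] by fastforce
  then obtain z where z: "z \<in> ?Z" "adj (last ps) z" "z \<noteq> u" "z \<notin> set ps" by blast
  have "\<forall>i\<le>Suc k. (ps @ [z]) ! i \<in> (if even i then X else Y)"
    using ps(1,5) z(1) by (auto simp: nth_append le_Suc_eq)
  then show ?case
    using ps z by (intro exI[of _ "ps @ [z]"]) (auto simp: successively_append_iff)
qed

end

section \<open>Cycles of every odd length in a range\<close>

context expander
begin

text \<open>With n = \<open>card W\<close>, at least n/(2K) neighbours of \<open>u\<close>, each of
  degree at least n/(2K), give n^2/(4K^2) pairs between the neighbourhood and \<open>W\<close>.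
  Minimum degree \<open>L + 2\<close> needs more than (L + 2)(|N| + n) pairs, where N is the
  neighbourhood, and the constant 16 guarantees this with a factor 2 to spare.\<close>

lemma path_hitting_neighbours:
  assumes u: "u \<in> W" and n: "16 * K * K * (L + 2) \<le> card W"
  shows "\<exists>ps. length ps = L + 1 \<and> distinct ps \<and> set ps \<subseteq> W - {u} \<and> successively adj ps \<and>
    (\<forall>i\<le>L. even i \<longrightarrow> adj u (ps ! i))"
proof -
  let ?N = "{v \<in> W. adj u v}" and ?n = "card W"
  have two: "?n \<ge> 2"
  proof -
    have "2 \<le> 16 * K * K * (L + 2)" using K_pos by (cases K) auto
    then show ?thesis using n by simp
  qed
  have finN: "finite ?N" using finite_W by auto
  have N: "?n \<le> 2 * K * card ?N" by (rule degree_W[OF u two])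
  have "card ?N * ?n \<le> 2 * K * card (crossing ?N W)"
    using degree_W[OF _ two] finite_W by (intro crossing_ge) auto
  then have "2 * K * (card ?N * ?n) \<le> 2 * K * (2 * K * card (crossing ?N W))"
    by (rule mult_le_mono2)
  also have "2 * K * (card ?N * ?n) = 2 * K * card ?N * ?n" by simp
  also have "2 * K * (2 * K * card (crossing ?N W)) = 4 * K * K * card (crossing ?N W)" by simp
  finally have "?n * ?n \<le> 4 * K * K * card (crossing ?N W)"
    by (rule order.trans[OF mult_le_mono1[OF N]])
  moreover have "card ?N \<le> ?n" using finite_W by (intro card_mono) auto
  then have "4 * K * K * ((L + 2) * (card ?N + ?n)) \<le> 4 * K * K * ((L + 2) * (?n + ?n))"
    by (intro mult_le_mono2) auto
  moreover have "2 * (4 * K * K * ((L + 2) * (?n + ?n))) \<le> ?n * ?n"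
    using mult_le_mono1[OF n, of ?n] by (simp add: algebra_simps)
  moreover have "?n * ?n > 0" using two by simp
  ultimately have "4 * K * K * ((L + 2) * (card ?N + ?n)) < 4 * K * K * card (crossing ?N W)"
    by linarith
  then have "(L + 2) * (card ?N + ?n) < card (crossing ?N W)" by simp
  from crossing_min_degree[OF finN finite_W this] obtain X Y where XY: "X \<subseteq> ?N" "Y \<subseteq> W" "X \<noteq> {}" "\<forall>x\<in>X. L + 2 \<le> card {y \<in> Y. adj x y}"
      "\<forall>y\<in>Y. L + 2 \<le> card {x \<in> X. adj y x}"
    by (elim exE conjE) (rule that)
  have "finite X" "finite Y" "u \<notin> X"
    using XY finite_W adj_irrefl by (auto intro: finite_subset)
  then obtain ps where ps: "length ps = L + 1" "distinct ps" "u \<notin> set ps" "successively adj ps"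
      "\<forall>i\<le>L. ps ! i \<in> (if even i then X else Y)"
    using alternating_path[of X Y L u L] XY by auto
  have "set ps \<subseteq> W"
  proof
    fix x assume "x \<in> set ps"
    then obtain i where i: "i \<le> L" "ps ! i = x" using ps(1)
      by (metis Suc_eq_plus1 in_set_conv_nth less_Suc_eq_le)
    then have "x \<in> (if even i then X else Y)" using ps(5) by blast
    then show "x \<in> W" using XY(1,2) by (auto split: if_splits)
  qed
  moreover have "adj u (ps ! i)" if "i \<le> L" "even i" for i
    using ps(5) that XY(1) by fastforce
  ultimately show ?thesis using ps by (intro exI[of _ ps]) auto
qed

text \<open>Since a path with every second vertex adjacent to a vertex \<^term>\<open>u\<close> can be left towards
  \<^term>\<open>u\<close> after any even number of steps, it adjusts the length of the cycle.\<close>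
lemma cycle_of_length:
  assumes m: "odd m" "16 * K + 11 \<le> m" and n: "100 * K * K * m \<le> card W"
  shows "\<exists>cs. cyclic cs \<and> distinct cs \<and> length cs = m \<and> set cs \<subseteq> W"
proof -
  obtain u where u: "u \<in> W" using W_nonempty by auto
  have "16 * K * K * (m + 2) \<le> 16 * K * K * (3 * m)" using m by (intro mult_le_mono2) auto
  also have "\<dots> \<le> 100 * K * K * m" by simp
  also note n
  finally have "16 * K * K * (m + 2) \<le> card W" .
  then obtain ps where ps: "length ps = m + 1" "distinct ps" "set ps \<subseteq> W - {u}" "successively adj ps"
      "\<forall>i\<le>m. even i \<longrightarrow> adj u (ps ! i)"
    using path_hitting_neighbours[OF u] by blast
  obtain p rest where p: "ps = p # rest" using ps(1) by (cases ps) auto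
  have lrest: "length rest = m" using ps(1) p by simp
  \<comment> \<open>All of \<open>ps\<close> except \<open>p\<close> is deleted, so that the path
    back to \<open>u\<close> meets it in \<open>p\<close> only.\<close>
  have "4 * K * (card (set rest) + 4 * K + 5) \<le> 4 * K * (2 * m)"
    using m(2) card_length[of rest] lrest by (intro mult_le_mono2) auto
  also have "\<dots> \<le> 100 * K * K * m" using K_pos by (cases K) auto
  also note n
  finally have "4 * K * (card (set rest) + 4 * K + 5) \<le> card W" .
  then have "\<exists>xs. walk (W - set rest) p u xs \<and> distinct xs \<and> odd (length xs) \<and> length xs \<le> 16 * K + 11"
    using ps(2,3) p u by (intro even_path_avoiding) auto
  then obtain xs where xs: "walk (W - set rest) p u xs" "distinct xs" "odd (length xs)"
      "length xs \<le> 16 * K + 11" by blast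
  \<comment> \<open>The closing path has at most 16K + 11, hence at most \<open>m\<close>, vertices.
    Both \<open>m\<close> and its length are odd, so an even number of vertices is missing, and
    after an even number of steps along \<open>ps\<close> the current vertex is adjacent to
    \<open>u\<close>.\<close>
  define j where "j = m - length xs"
  have j: "even j" "length xs + j = m" "j \<le> m" using m xs(3,4) by (auto simp: j_def)
  let ?qs = "take j rest"
  have lq: "length ?qs = j" using lrest j by simp
  have last: "adj u (last (p # ?qs))"
  proof -
    have "last (p # ?qs) = ps ! j"
      using lq lrest j(3) p by (cases j) (auto simp: last_conv_nth nth_append)
    then show ?thesis using ps(5) j by simp
  qed
  have "successively adj (p # ?qs)"
    using ps(4) p successively_append_iff[of adj "p # ?qs" "drop j rest"] by simp
  then have s: "successively adj (rev ?qs @ [p])" using successively_adj_rev[of "p # ?qs"] by simp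
  let ?cs = "xs @ rev ?qs"
  have "cyclic ?cs"
  proof (cases "?qs = []")
    case True
    then show ?thesis using xs(1) last unfolding cyclic_def walk_def by auto
  next
    case False
    then have "adj (last (rev ?qs)) p" "successively adj (rev ?qs)"
      using s successively_append_iff[of adj "rev ?qs" "[p]"] by auto
    moreover have "adj u (hd (rev ?qs))" using last False by (simp add: hd_rev)
    ultimately show ?thesis using xs(1) False
      unfolding cyclic_def walk_def by (auto simp: successively_append_iff simp del: successively_rev)
  qed
  moreover have "set ?qs \<subseteq> set rest" by (rule set_take_subset)
  then have "distinct ?cs" "set ?cs \<subseteq> W"
    using xs(1,2) ps(2,3) p by (auto simp: walk_def)
  ultimately show ?thesis using j lq by (intro exI[of _ ?cs]) auto
qed

end

text \<open>The expanding subset keeps at least a fraction 1/(2K) of the vertices, which turns 100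
  K^2 m into 200 K^3 m; and 27K bounds 16K + 11.\<close>

lemma (in adjacency) cycle_of_length_if_far_bipartite:
  fixes K :: nat
  assumes V: "finite V" "V \<noteq> {}" and K: "K > 0"
    and far: "\<And>c. card (mono_pairs c V) * K \<ge> (card V)\<^sup>2"
    and m: "odd m" "27 * K \<le> m" and n: "200 * K ^ 3 * m \<le> card V"
  shows "\<exists>cs. cyclic cs \<and> distinct cs \<and> length cs = m \<and> set cs \<subseteq> V"
proof -
  obtain W where W: "W \<subseteq> V" "W \<noteq> {}" "card W * (2 * K) \<ge> card V"
      "\<And>c. card (mono_pairs c W) * K \<ge> (card W)\<^sup>2"
      "\<And>A. A \<subseteq> W \<Longrightarrow> A \<noteq> {} \<Longrightarrow> A \<noteq> W \<Longrightarrow> card (crossing A (W - A)) * K \<ge> card A * card (W - A)"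
    using expander_subset[OF V K far] by metis
  interpret expander adj W K
    using W V(1) by unfold_locales (auto intro: finite_subset)
  have "2 * K * (100 * K * K * m) = 200 * K ^ 3 * m" by (simp add: power3_eq_cube)
  also note n
  also note W(3)
  also have "card W * (2 * K) = 2 * K * card W" by simp
  finally have "2 * K * (100 * K * K * m) \<le> 2 * K * card W" .
  then have "100 * K * K * m \<le> card W" using K by (simp only: mult_le_cancel1)
  then show ?thesis using cycle_of_length[of m] m K W(1) by fastforce
qed

section \<open>Blow-ups of odd cycles\<close>

lemma odd_cycle_not_2_colourable:
  fixes c :: "nat \<Rightarrow> bool"
  assumes "odd m"
  shows "\<exists>i<m. c i = c ((i + 1) mod m)"
proof (rule ccontr)
  assume "\<not> ?thesis"
  then have alt: "c i \<noteq> c ((i + 1) mod m)" if "i < m" for i using that by blast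
  have par: "c i = (c 0 = even i)" if "i < m" for i
    using that
  proof (induction i)
    case (Suc i)
    then have "c (Suc i) = (\<not> c i)" using alt[of i] by simp
    moreover have "c i = (c 0 = even i)" using Suc by simp
    moreover have "even (Suc i) = (\<not> even i)" by simp
    ultimately show ?case by blast
  qed simp
  have "m > 0" using assms by (cases m) auto
  moreover have "even (m - 1)" using assms by simp
  ultimately have "c (m - 1) = c 0" using par[of "m - 1"] by simp
  moreover have "(m - 1 + 1) mod m = 0" using \<open>m > 0\<close> by simp
  ultimately show False using alt[of "m - 1"] \<open>m > 0\<close> by (metis diff_less zero_less_one)
qed

lemma adjacency_edges:
  assumes "\<And>e. e \<in> E \<Longrightarrow> card e = 2"
  shows "adjacency (\<lambda>u v. {u, v} \<in> E)"
  using assms[of "{u, u}" for u] by unfold_locales (auto simp: insert_commute)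

lemma contains_copy_cycle_graphD:
  assumes "contains_copy (cycle_graph m) G"
  obtains f where "inj_on f {..<m}" "f ` {..<m} \<subseteq> verts G"
    "\<And>i. i < m \<Longrightarrow> {f i, f ((i + 1) mod m)} \<in> edges G"
proof -
  obtain f where f: "inj_on f {..<m}" "f ` {..<m} \<subseteq> verts G"
      "\<And>e. e \<in> edges (cycle_graph m) \<Longrightarrow> f ` e \<in> edges G"
    using assms by (auto simp: contains_copy_def cycle_graph_def)
  have "{f i, f ((i + 1) mod m)} \<in> edges G" if "i < m" for i
    using f(3)[of "{i, (i + 1) mod m}"] that by (auto simp: cycle_graph_def)
  then show ?thesis using that f(1,2) by blast
qed

lemma contains_copy_if_cyclic:
  assumes E: "\<And>e. e \<in> edges G \<Longrightarrow> card e = 2"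
    and cs: "adjacency.cyclic (\<lambda>u v. {u, v} \<in> edges G) cs" "distinct cs" "set cs \<subseteq> verts G"
  shows "contains_copy (cycle_graph (length cs)) G"
proof -
  interpret adjacency "\<lambda>u v. {u, v} \<in> edges G" by (rule adjacency_edges[OF E])
  have "{cs ! i, cs ! ((i + 1) mod length cs)} \<in> edges G" if i: "i < length cs" for i
  proof (cases "Suc i < length cs")
    case True
    then show ?thesis using cs(1) by (simp add: cyclic_def successively_conv_nth)
  next
    case False
    then have "Suc i = length cs" using i by simp
    moreover have "cs \<noteq> []" using i by auto
    moreover have "last cs = cs ! i" using calculation by (simp add: last_conv_nth flip: \<open>Suc i = _\<close>)
    ultimately show ?thesis using cs(1) by (simp add: cyclic_def hd_conv_nth)
  qed
  then have "((!) cs) ` e \<in> edges G" if "e \<in> edges (cycle_graph (length cs))" for e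
    using that by (auto simp: cycle_graph_def)
  then show ?thesis
    using cs(2,3) unfolding contains_copy_def
    by (intro exI[of _ "(!) cs"]) (auto simp: cycle_graph_def inj_on_nth)
qed

lemma no_odd_cycle_if_2_colourable:
  assumes "odd m" "\<And>u v. {u, v} \<in> edges G \<Longrightarrow> c u \<noteq> (c v :: bool)"
  shows "\<not> contains_copy (cycle_graph m) G"
proof
  assume "contains_copy (cycle_graph m) G"
  then obtain f where "inj_on f {..<m}" "f ` {..<m} \<subseteq> verts G"
      "\<And>i. i < m \<Longrightarrow> {f i, f ((i + 1) mod m)} \<in> edges G"
    by (rule contains_copy_cycle_graphD) blast
  then show False using odd_cycle_not_2_colourable[OF assms(1), of "c \<circ> f"] assms(2) by auto
qed

text \<open>Removing the monochromatic edges of any colouring leaves a bipartite graph, which is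
  free of all odd cycles and so of all lengths in \<open>L\<close>.\<close>

lemma mono_pairs_if_far:
  assumes G: "finite_simple_graph G" and far: "far_from_cycles_free \<epsilon> L G"
    and L: "\<And>m. m \<in> L \<Longrightarrow> odd m"
  shows "\<epsilon> * real (card (verts G)) ^ 2 \<le>
    card (adjacency.mono_pairs (\<lambda>u v. {u, v} \<in> edges G) c (verts G))"
proof -
  have "\<And>e. e \<in> edges G \<Longrightarrow> card e = 2" using G by (auto simp: finite_simple_graph_def)
  then interpret adjacency "\<lambda>u v. {u, v} \<in> edges G" by (rule adjacency_edges)
  have fin: "finite (verts G)" using G by (simp add: finite_simple_graph_def)
  let ?F = "(\<lambda>(u, v). {u, v}) ` mono_pairs c (verts G)"
  have V: "u \<in> verts G" "v \<in> verts G" if "{u, v} \<in> edges G" for u v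
    using G that by (auto simp: finite_simple_graph_def)
  have "c u \<noteq> c v" if "{u, v} \<in> edges (remove_edges G ?F)" for u v
    using that V by (auto simp: remove_edges_def mono_pairs_def)
  then have "cycles_free L (remove_edges G ?F)"
    unfolding cycles_free_def using no_odd_cycle_if_2_colourable L by blast
  moreover have "?F \<subseteq> edges G" by (auto simp: mono_pairs_def)
  ultimately have "\<epsilon> * real (card (verts G)) ^ 2 \<le> card ?F"
    using far by (auto simp: far_from_cycles_free_def)
  also have "card ?F \<le> card (mono_pairs c (verts G))"
    using fin by (intro card_image_le finite_mono_pairs)
  finally show ?thesis by simp
qed

section \<open>The blow-up and its distance from being L-free\<close>

definition blowup :: "nat \<Rightarrow> nat \<Rightarrow> nat sgraph" where
  "blowup k t = ({..<k * t}, {{u, v} | u v. u < k * t \<and> v < k * t \<and> (u + 1) mod k = v mod k})"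

text \<open>The part of a vertex is its residue modulo \<open>k\<close>, so adjacency is a
  congruence and every part has \<open>t\<close> vertices.\<close>

lemma edges_blowup_iff:
  "{u, v} \<in> edges (blowup k t) \<longleftrightarrow>
    u < k * t \<and> v < k * t \<and> ((u + 1) mod k = v mod k \<or> (v + 1) mod k = u mod k)"
  unfolding blowup_def by (auto simp: doubleton_eq_iff)

lemma verts_blowup: "verts (blowup k t) = {..<k * t}"
  by (simp add: blowup_def)

lemma finite_simple_graph_blowup:
  assumes "k \<ge> 2"
  shows "finite_simple_graph (blowup k t)"
proof -
  have "u \<noteq> v" if "(u + 1) mod k = v mod k" for u v
  proof
    assume "u = v"
    then have "u mod k = (if Suc (u mod k) = k then 0 else Suc (u mod k))"
      using that mod_Suc[of u k] by simp
    then show False using assms by (cases "Suc (u mod k) = k") auto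
  qed
  then have "card {u, v} = 2" if "(u + 1) mod k = v mod k" for u v
    using that by (metis card_2_iff)
  then show ?thesis unfolding finite_simple_graph_def blowup_def by fastforce
qed

lemma sum_cyclic_shift:
  fixes h :: "nat \<Rightarrow> int"
  shows "(\<Sum>i<s. h ((i + 1) mod s)) = (\<Sum>i<s. h i)"
proof (cases s)
  case (Suc r)
  have "(\<Sum>i<s. h ((i + 1) mod s)) = (\<Sum>i<r. h (Suc i)) + h 0"
    unfolding Suc sum.lessThan_Suc by simp
  also have "\<dots> = (\<Sum>i<s. h i)" unfolding Suc sum.lessThan_Suc_shift by simp
  finally show ?thesis .
qed simp

text \<open>Along a closed walk in the blow-up, the index of the part changes by 1 or -1 in each step,
  and a number of such steps smaller than the number of parts cannot wind around.\<close>
lemma blowup_no_short_odd_cycle: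
  assumes "odd s" "s < k"
  shows "\<not> contains_copy (cycle_graph s) (induced_subgraph (blowup k t) S)"
proof
  assume "contains_copy (cycle_graph s) (induced_subgraph (blowup k t) S)"
  then obtain f where
    "inj_on f {..<s}" "f ` {..<s} \<subseteq> verts (induced_subgraph (blowup k t) S)"
    and edges: "\<And>i. i < s \<Longrightarrow> {f i, f ((i + 1) mod s)} \<in> edges (induced_subgraph (blowup k t) S)"
    by (rule contains_copy_cycle_graphD) blast
  have f: "(f i + 1) mod k = f ((i + 1) mod s) mod k \<or> (f ((i + 1) mod s) + 1) mod k = f i mod k"
    if "i < s" for i
    using edges[OF that] by (auto simp: induced_subgraph_def edges_blowup_iff)
  define h where "h i = int (f i)" for i
  have "\<exists>d \<in> {1, -1}. int k dvd (h ((i + 1) mod s) - h i - d)" if "i < s" for i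
    using f[OF that]
  proof
    assume "(f i + 1) mod k = f ((i + 1) mod s) mod k"
    then have "(h i + 1) mod int k = h ((i + 1) mod s) mod int k"
      unfolding h_def by (metis of_nat_1 of_nat_add of_nat_mod)
    then have "int k dvd h ((i + 1) mod s) - (h i + 1)" by (metis mod_eq_dvd_iff)
    then show ?thesis by (auto simp: algebra_simps)
  next
    assume "(f ((i + 1) mod s) + 1) mod k = f i mod k"
    then have "(h ((i + 1) mod s) + 1) mod int k = h i mod int k"
      unfolding h_def by (metis of_nat_1 of_nat_add of_nat_mod)
    then have "int k dvd h ((i + 1) mod s) + 1 - h i" by (metis mod_eq_dvd_iff)
    then show ?thesis by (auto simp: algebra_simps)
  qed
  then obtain d where d: "\<And>i. i < s \<Longrightarrow> d i \<in> {1, -1} \<and> int k dvd (h ((i + 1) mod s) - h i - d i)"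
    by metis
  have "int k dvd (\<Sum>i<s. h ((i + 1) mod s) - h i - d i)"
    using d by (intro dvd_sum) auto
  \<comment> \<open>The differences of \<open>h\<close> cancel around the cycle. What remains is a
    multiple of \<open>k\<close> of absolute value at most \<open>s\<close>, and
    \<open>s < k\<close> makes it 0.\<close>
  then have "int k dvd (\<Sum>i<s. d i)"
    by (simp add: sum_subtractf sum_cyclic_shift[of h s, simplified])
  moreover have "\<bar>\<Sum>i<s. d i\<bar> \<le> (\<Sum>i<s. \<bar>d i\<bar>)" by (rule sum_abs)
  moreover have "\<bar>d i\<bar> = 1" if "i < s" for i using d[OF that] by auto
  then have "(\<Sum>i<s. \<bar>d i\<bar>) = (\<Sum>i<s. 1)" by (intro sum.cong) auto
  ultimately have "(\<Sum>i<s. d i) = 0"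
    using assms(2) dvd_imp_le_int[of "\<Sum>i<s. d i" "int k"] by force
  \<comment> \<open>A sum of \<open>s\<close> signs has the parity of \<open>s\<close>, so it cannot
    vanish for odd \<open>s\<close>.\<close>
  moreover have "even (\<Sum>i<s. d i - 1)" using d by (intro dvd_sum) fastforce
  ultimately show False using assms(1) by (simp add: sum_subtractf)
qed

text \<open>Majority colours of the parts cannot alternate around an odd cycle, so two consecutive
  parts share theirs. The vertices of that colour, at least t/2 in each of the two parts, span t^2/4
  monochromatic pairs.\<close>

lemma blowup_mono_pairs:
  assumes k: "odd k" "k \<ge> 3"
  shows "t\<^sup>2 \<le> 4 * card (adjacency.mono_pairs (\<lambda>u v. {u, v} \<in> edges (blowup k t)) c {..<k * t})"
proof -
  have "\<And>e. e \<in> edges (blowup k t) \<Longrightarrow> card e = 2"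
    using finite_simple_graph_blowup[of k t] k by (auto simp: finite_simple_graph_def)
  then interpret adjacency "\<lambda>u v. {u, v} \<in> edges (blowup k t)" by (rule adjacency_edges)
  define P where "P i b = {v. v < k * t \<and> v mod k = i \<and> c v = b}" for i b
  have fin: "finite (P i b)" for i b by (rule finite_subset[of _ "{..<k * t}"]) (auto simp: P_def)
  have half: "t \<le> 2 * card (P i True) \<or> t \<le> 2 * card (P i False)" if "i < k" for i
  proof -
    have "(\<lambda>j. i + k * j) ` {..<t} \<subseteq> P i True \<union> P i False"
    proof clarify
      fix j assume "j < t" "i + k * j \<notin> P i False"
      moreover have "k * (j + 1) \<le> k * t" using \<open>j < t\<close> by (intro mult_le_mono2) simp
      ultimately show "i + k * j \<in> P i True" using that by (auto simp: P_def)
    qed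
    then have "card ((\<lambda>j. i + k * j) ` {..<t}) \<le> card (P i True \<union> P i False)"
      using fin by (intro card_mono) auto
    also have "\<dots> \<le> card (P i True) + card (P i False)" by (rule card_Un_le)
    also have "card ((\<lambda>j. i + k * j) ` {..<t}) = t"
      using k by (subst card_image) (auto simp: inj_on_def)
    finally show ?thesis by linarith
  qed
  define M where "M i \<longleftrightarrow> t \<le> 2 * card (P i True)" for i
  have M: "t \<le> 2 * card (P i (M i))" if "i < k" for i
    using half[OF that] by (cases "t \<le> 2 * card (P i True)") (auto simp: M_def)
  obtain i where i: "i < k" "M i = M ((i + 1) mod k)"
    using odd_cycle_not_2_colourable[OF k(1), of M] by blast
  let ?A = "P i (M i)" and ?B = "P ((i + 1) mod k) (M i)"
  have "t \<le> 2 * card ?A" "t \<le> 2 * card ?B"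
    using M[of i] M[of "(i + 1) mod k"] i by auto
  then have "t * t \<le> (2 * card ?A) * (2 * card ?B)" by (rule mult_le_mono)
  also have "\<dots> = 4 * card (?A \<times> ?B)" by (simp add: card_cartesian_product)
  also have "?A \<times> ?B \<subseteq> mono_pairs c {..<k * t}"
    by (auto simp: P_def mono_pairs_def) (auto simp: edges_blowup_iff mod_Suc_eq)
  then have "4 * card (?A \<times> ?B) \<le> 4 * card (mono_pairs c {..<k * t})"
    by (intro mult_le_mono2 card_mono finite_mono_pairs) auto
  finally show ?thesis by (simp add: power2_eq_square)
qed

lemma card_ordered_pairs_le:
  assumes "finite F"
  shows "finite {(u, v). {u, v} \<in> F}" "card {(u, v). {u, v} \<in> F} \<le> 2 * card F"
proof -
  have "finite {(u, v). {u, v} = e} \<and> card {(u, v). {u, v} = e} \<le> 2" for e :: "'a set"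
  proof (cases "\<exists>u v. e = {u, v}")
    case True
    then obtain u v where "e = {u, v}" by blast
    then have sub: "{(u, v). {u, v} = e} \<subseteq> {(u, v), (v, u)}" by (auto simp: doubleton_eq_iff)
    then have "card {(u, v). {u, v} = e} \<le> card {(u, v), (v, u)}" by (intro card_mono) auto
    also have "\<dots> \<le> 2" by (cases "u = v") auto
    finally show ?thesis using finite_subset[OF sub] by simp
  next
    case False
    then have "{(u, v). {u, v} = e} = {}" by auto
    then show ?thesis by (metis card.empty finite.emptyI zero_le)
  qed
  note e = this
  have eq: "{(u, v). {u, v} \<in> F} = (\<Union>e\<in>F. {(u, v). {u, v} = e})" by auto
  show "finite {(u, v). {u, v} \<in> F}" unfolding eq using assms e by blast
  have "card (\<Union>e\<in>F. {(u, v). {u, v} = e}) \<le> (\<Sum>e\<in>F. card {(u, v). {u, v} = e})"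
    using assms by (rule card_UN_le)
  also have "\<dots> \<le> (\<Sum>e\<in>F. 2)" using e by (intro sum_mono) auto
  finally show "card {(u, v). {u, v} \<in> F} \<le> 2 * card F" by (simp add: eq)
qed

text \<open>With n = kt vertices the claimed distance is t^2/16 edges, or t^2/8 ordered pairs. Fewer
  removals leave at least t^2/8 of the t^2/4 monochromatic pairs of any colouring, which is
  n^2/(8k^2). Hence \<open>cycle_of_length_if_far_bipartite\<close> applies with K = 8k^2, and 216
  is 27 * 8.\<close>

lemma blowup_far:
  assumes k: "odd k" "k \<ge> 3" and m: "odd m" "216 * k\<^sup>2 \<le> m" "m \<in> L"
    and t: "200 * (8 * k\<^sup>2) ^ 3 * m \<le> t"
  shows "far_from_cycles_free (1 / (16 * real k ^ 2)) L (blowup k t)"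
  unfolding far_from_cycles_free_def
proof (intro allI impI, rule ccontr)
  let ?G = "blowup k t" and ?V = "{..<k * t}"
  fix F assume F: "F \<subseteq> edges ?G" and free: "cycles_free L (remove_edges ?G F)"
    and "\<not> 1 / (16 * real k ^ 2) * real (card (verts ?G)) ^ 2 \<le> real (card F)"
  then have "16 * real (card F) < real t ^ 2"
    using k by (simp add: verts_blowup field_simps)
  then have small: "16 * card F < t\<^sup>2"
    by (simp flip: of_nat_less_iff[where 'a = real])
  let ?H = "remove_edges ?G F"
  have E: "e \<in> edges ?G \<Longrightarrow> card e = 2" "finite (edges ?G)" for e
    using finite_simple_graph_blowup[of k t] k
    by (auto simp: finite_simple_graph_def intro: finite_subset[of _ "Pow {..<k * t}"] simp: verts_blowup)
  then have E': "\<And>e. e \<in> edges ?H \<Longrightarrow> card e = 2" by (auto simp: remove_edges_def)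
  interpret G: adjacency "\<lambda>u v. {u, v} \<in> edges ?G" by (rule adjacency_edges[OF E(1)])
  interpret H: adjacency "\<lambda>u v. {u, v} \<in> edges ?H" by (rule adjacency_edges[OF E'])
  have finF: "finite F" using F E(2) by (rule finite_subset)
  have far: "(card ?V)\<^sup>2 \<le> card (H.mono_pairs c ?V) * (8 * k\<^sup>2)" for c
  proof -
    have "G.mono_pairs c ?V \<subseteq> H.mono_pairs c ?V \<union> {(u, v). {u, v} \<in> F}"
      by (auto simp: G.mono_pairs_def H.mono_pairs_def) (auto simp: remove_edges_def)
    then have "card (G.mono_pairs c ?V) \<le> card (H.mono_pairs c ?V \<union> {(u, v). {u, v} \<in> F})"
      using card_ordered_pairs_le[OF finF] H.finite_mono_pairs[of ?V c] by (intro card_mono) auto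
    also have "\<dots> \<le> card (H.mono_pairs c ?V) + card {(u, v). {u, v} \<in> F}" by (rule card_Un_le)
    finally have "t\<^sup>2 \<le> 8 * card (H.mono_pairs c ?V)"
      using blowup_mono_pairs[OF k, of t c] card_ordered_pairs_le(2)[OF finF] small by linarith
    then have "k\<^sup>2 * t\<^sup>2 \<le> k\<^sup>2 * (8 * card (H.mono_pairs c ?V))" by (rule mult_le_mono2)
    then show ?thesis by (simp add: power_mult_distrib algebra_simps)
  qed
  have "t \<le> k * t" using k by simp
  with t have "200 * (8 * k\<^sup>2) ^ 3 * m \<le> k * t" by (rule order.trans)
  then have "200 * (8 * k\<^sup>2) ^ 3 * m \<le> card ?V" by simp
  moreover have "m > 0" using m by (cases m) auto
  then have "0 < 200 * (8 * k\<^sup>2) ^ 3 * m" using k by simp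
  then have "card ?V > 0" using calculation(1) by (rule less_le_trans)
  then have "?V \<noteq> {}" by (metis card.empty less_irrefl)
  ultimately obtain cs where "H.cyclic cs" "distinct cs" "length cs = m" "set cs \<subseteq> ?V"
    using H.cycle_of_length_if_far_bipartite[of ?V "8 * k\<^sup>2" m, OF _ _ _ far] k m by auto
  then have "contains_copy (cycle_graph m) ?H"
    using contains_copy_if_cyclic[of ?H cs, OF E'] by (simp add: remove_edges_def verts_blowup)
  then show False using free m(3) by (auto simp: cycles_free_def)
qed

text \<open>Fewer than \<open>m\<close> vertices cannot hold a cycle of length \<open>m\<close> or
  more, and the blow-up has no odd cycle shorter than \<open>k\<close>. By \<open>gap\<close> this
  covers all of \<open>L\<close>, so smaller samples succeed with probability 0.\<close>

lemma sample_size_ge_gap: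
  assumes k: "odd k" "k \<ge> 3" and m: "odd m" "216 * k\<^sup>2 \<le> m" "m \<in> L"
    and gap: "\<And>s. s \<in> L \<Longrightarrow> odd s \<and> (s < k \<or> m \<le> s)"
    and w: "sample_size_suffices L (1 / (16 * real k ^ 2)) w"
  shows "m \<le> w"
proof (rule ccontr)
  assume "\<not> m \<le> w"
  obtain N where N: "\<And>G :: nat sgraph. finite_simple_graph G \<Longrightarrow> card (verts G) \<ge> N \<Longrightarrow>
      far_from_cycles_free (1 / (16 * real k ^ 2)) L G \<Longrightarrow>
      measure_pmf.prob (random_vertex_set G w) {S. \<not> cycles_free L (induced_subgraph G S)} \<ge> 2 / 3"
    using w unfolding sample_size_suffices_def by blast
  \<comment> \<open>The summands ensure that the blow-up passes the threshold \<open>N\<close>, that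
    it has subsets of size \<open>w\<close>, and that \<open>blowup_far\<close> applies.\<close>
  define t where "t = N + w + 200 * (8 * k\<^sup>2) ^ 3 * m"
  let ?G = "blowup k t"
  have kt: "t \<le> k * t" using k by simp
  then have *: "measure_pmf.prob (random_vertex_set ?G w) {S. \<not> cycles_free L (induced_subgraph ?G S)} \<ge> 2 / 3"
  proof (intro N finite_simple_graph_blowup blowup_far[OF k m])
    have "N \<le> t" by (simp add: t_def)
    then have "N \<le> k * t" using kt by (rule order.trans)
    then show "N \<le> card (verts ?G)" by (simp add: verts_blowup)
  qed (use k in \<open>auto simp: t_def\<close>)
  have free: "cycles_free L (induced_subgraph ?G S)" if S: "card S = w" "S \<subseteq> verts ?G" for S
    unfolding cycles_free_def
  proof
    fix s assume s: "s \<in> L"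
    show "\<not> contains_copy (cycle_graph s) (induced_subgraph ?G S)"
    proof (cases "s < k")
      case True
      then show ?thesis using gap[OF s] blowup_no_short_odd_cycle by blast
    next
      case False
      show ?thesis
      proof
        assume "contains_copy (cycle_graph s) (induced_subgraph ?G S)"
        then obtain f where f: "inj_on f {..<s}" "f ` {..<s} \<subseteq> verts (induced_subgraph ?G S)"
            "\<And>i. i < s \<Longrightarrow> {f i, f ((i + 1) mod s)} \<in> edges (induced_subgraph ?G S)"
          by (rule contains_copy_cycle_graphD) blast
        have "finite S" using S(2) by (rule finite_subset) (simp add: verts_blowup)
        then have "s \<le> card S"
          using card_inj_on_le[OF f(1), of S] f(2) by (auto simp: induced_subgraph_def)
        then show False using False gap[OF s] S \<open>\<not> m \<le> w\<close> by auto
      qed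
    qed
  qed
  let ?A = "{S. S \<subseteq> verts ?G \<and> card S = w}"
  have "w \<le> t" by (simp add: t_def)
  then have "w \<le> k * t" using kt by (rule order.trans)
  then have "w \<le> card (verts ?G)" by (simp add: verts_blowup)
  then obtain T where "T \<subseteq> verts ?G" "card T = w" by (rule obtain_subset_with_card_n)
  then have "?A \<noteq> {}" by blast
  moreover have "finite ?A" by (rule finite_subset[of _ "Pow (verts ?G)"]) (auto simp: verts_blowup)
  ultimately have "measure_pmf.prob (random_vertex_set ?G w) {S. \<not> cycles_free L (induced_subgraph ?G S)} =
      card (?A \<inter> {S. \<not> cycles_free L (induced_subgraph ?G S)}) / card ?A"
    unfolding random_vertex_set_def by (rule measure_pmf_of_set)
  also have "?A \<inter> {S. \<not> cycles_free L (induced_subgraph ?G S)} = {}" using free by auto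
  finally show False using * by simp
qed

section \<open>Polynomial sample complexity bounds the gaps\<close>

lemma bounded_gaps_if_poly:
  fixes l :: "nat \<Rightarrow> nat"
  assumes l: "strict_mono l" "\<And>j. odd (l j)" "l 0 \<ge> 3"
    and poly: "poly_sample_complexity (range l)"
  shows "\<exists>B. \<forall>j. ln (real (l (Suc j))) / ln (real (l j)) \<le> B"
proof -
  obtain C where C: "\<And>\<epsilon>. \<epsilon> \<in> {0<..<1} \<Longrightarrow>
      ereal_of_enat (sample_complexity (range l) \<epsilon>) \<le> ereal (C * \<epsilon> powr (- C))"
    using poly unfolding poly_sample_complexity_def by blast
  \<comment> \<open>The sign of \<open>C\<close> is not known; a constant that is at least 1 makes
    the bounds below monotone.\<close>
  define D where "D = max C 1"
  have D: "D \<ge> 1" "C \<le> D" by (auto simp: D_def)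
  have "ln (real (l (Suc j))) / ln (real (l j)) \<le> 220 + 21 * D" for j
  proof -
    let ?x = "ln (real (l j))"
    define k where "k = l j + 2"
    define m where "m = l (Suc j)"
    have lj: "l j \<ge> 3" using l(1,3) by (meson le_trans strict_mono_less_eq zero_le)
    \<comment> \<open>A logarithm of at least 1 lets additive constants be absorbed into multiples
      of \<open>?x\<close>.\<close>
    have "ln (real (l j)) \<ge> ln (exp 1)" using lj exp_le by (subst ln_le_cancel_iff) auto
    then have x: "?x \<ge> 1" by simp
    have k: "odd k" "k \<ge> 3" using l(2)[of j] lj by (auto simp: k_def)
    have "l j + 2 \<le> 3 * l j" using lj by simp
    also have "\<dots> \<le> l j * l j" using lj by (rule mult_le_mono1)
    finally have "l j + 2 \<le> l j * l j" .
    then have "real k \<le> real (l j * l j)" unfolding k_def by (rule of_nat_mono)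
    then have "ln (real k) \<le> ln (real (l j * l j))" using k lj by (subst ln_le_cancel_iff) auto
    then have lnk: "ln (real k) \<le> 2 * ?x" using lj by (simp add: ln_mult)
    have mpos: "m > 0" using l(2)[of "Suc j"] by (cases m) (auto simp: m_def)
    have "ln (real m) \<le> (220 + 21 * D) * ?x"
    \<comment> \<open>A gap too small for \<open>blowup_far\<close> is polynomial outright and costs
      216 + 4 = 220. Otherwise the sample complexity at 1/(16k^2) bounds \<open>m\<close>, at a cost
      of (1 + 16 + 4)D = 21D.\<close>
    proof (cases "216 * k\<^sup>2 \<le> m")
      case False
      then have "m \<le> 216 * k\<^sup>2" by simp
      then have "real m \<le> real (216 * k\<^sup>2)" by (rule of_nat_mono)
      then have "ln (real m) \<le> ln (216 * real k ^ 2)" using mpos k by (subst ln_le_cancel_iff) auto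
      also have "\<dots> = ln 216 + 2 * ln (real k)" using k by (simp add: ln_mult ln_realpow)
      also have "\<dots> \<le> 216 * 1 + 4 * ?x" using lnk ln_bound[of 216] by simp
      also have "\<dots> \<le> 216 * ?x + 4 * ?x" using x by simp
      also have "\<dots> \<le> (220 + 21 * D) * ?x" using x D by (simp add: distrib_right)
      finally show ?thesis .
    next
      case True
      let ?\<epsilon> = "1 / (16 * real k ^ 2)"
      have "1 * 1 < 16 * real k ^ 2" using k by (intro mult_less_le_imp_less) (auto simp: one_le_power)
      then have \<epsilon>: "?\<epsilon> \<in> {0<..<1}" using k by (simp add: pos_divide_less_eq)
      have "m \<le> w" if "sample_size_suffices (range l) ?\<epsilon> w" for w
      proof (rule sample_size_ge_gap[OF k _ True _ _ that])
        show "odd m" "m \<in> range l" by (auto simp: m_def l(2))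
        fix s assume "s \<in> range l"
        then obtain i where "s = l i" by auto
        moreover have "l i \<le> l j \<or> l (Suc j) \<le> l i"
          using l(1) by (metis not_less_eq_eq strict_mono_less_eq)
        ultimately show "odd s \<and> (s < k \<or> m \<le> s)" using l(2) by (auto simp: k_def m_def)
      qed
      then have "enat m \<le> sample_complexity (range l) ?\<epsilon>"
        unfolding sample_complexity_def by (intro INF_greatest) auto
      then have "ereal_of_enat (enat m) \<le> ereal (C * ?\<epsilon> powr (- C))"
        using C[OF \<epsilon>] by (meson ereal_of_enat_le_iff order_trans)
      then have "real m \<le> C * ?\<epsilon> powr (- C)" by simp
      also have "?\<epsilon> powr (- C) = (16 * real k ^ 2) powr C"
        using \<epsilon> by (simp add: powr_minus powr_divide inverse_eq_divide)
      also have "C * (16 * real k ^ 2) powr C \<le> D * (16 * real k ^ 2) powr D"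
        using D \<epsilon> by (intro mult_mono powr_mono) (auto simp: field_simps)
      finally have "ln (real m) \<le> ln (D * (16 * real k ^ 2) powr D)"
        using mpos D k by (subst ln_le_cancel_iff) auto
      also have "\<dots> = ln D + D * (ln 16 + 2 * ln (real k))"
        using D k by (simp add: ln_mult ln_powr ln_realpow)
      also have "\<dots> \<le> D * ?x + D * (16 * ?x + 4 * ?x)"
      proof (intro add_mono mult_left_mono)
        have "ln D \<le> D * 1" using ln_bound[of D] D by simp
        also have "\<dots> \<le> D * ?x" using D x by (intro mult_left_mono) auto
        finally show "ln D \<le> D * ?x" .
        show "ln 16 \<le> 16 * ?x" using ln_bound[of 16] x by simp
      qed (use lnk D in auto)
      also have "\<dots> \<le> (220 + 21 * D) * ?x" using x by (simp add: algebra_simps)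
      finally show ?thesis .
    qed
    then show ?thesis using x by (simp add: m_def pos_divide_le_eq)
  qed
  then show ?thesis by blast
qed

section \<open>Sampling preserves the distance from bipartiteness\<close>

lemma power_one_minus_le_exp:
  fixes x :: real
  assumes "0 \<le> x" "x \<le> 1"
  shows "(1 - x) ^ n \<le> exp (- (real n * x))"
proof -
  have "(1 - x) ^ n \<le> exp (- x) ^ n"
    using assms exp_ge_add_one_self[of "- x"] by (intro power_mono) auto
  also have "\<dots> = exp (- (real n * x))" by (simp flip: exp_of_nat_mult)
  finally show ?thesis .
qed

text \<open>This is the birthday bound: at least half of all \<open>w\<close>-tuples have no
  repetition, by Bernoulli's inequality (1 - w/n)^w \<ge> 1 - w^2/n. It transfers estimates from
  independent samples to random sets.\<close>

lemma power_le_fact_mult_binomial: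
  assumes "2 * w\<^sup>2 \<le> n" "0 < n"
  shows "n ^ w \<le> 2 * fact w * (n choose w)"
proof -
  have wn: "w \<le> n" using assms by (cases w) (auto simp: power2_eq_square)
  have "real w * (real w / n) \<le> 1 / 2"
    using assms of_nat_mono[OF assms(1), where 'a = real]
    by (simp add: power2_eq_square pos_divide_le_eq)
  then have "1 / 2 \<le> 1 + real w * (- (real w / n))" by simp
  also have "\<dots> \<le> (1 + (- (real w / n))) ^ w"
    using wn assms(2) by (intro Bernoulli_inequality) (auto simp: field_simps)
  finally have "real n ^ w \<le> 2 * (real n ^ w * (1 - real w / n) ^ w)"
    using assms(2) mult_left_mono[of "1 / 2" "(1 - real w / n) ^ w" "real n ^ w"] by simp
  also have "real n ^ w * (1 - real w / n) ^ w = (real n - real w) ^ w"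
    using assms(2) by (simp add: right_diff_distrib flip: power_mult_distrib)
  also have "\<dots> = (\<Prod>i = 0..<w. real n - real w)" by simp
  also have "\<dots> \<le> (\<Prod>i = 0..<w. real n - real i)"
    using wn by (intro prod_mono) auto
  also have "\<dots> = fact w * (real n gchoose w)" by (simp add: gbinomial_mult_fact)
  finally have "real (n ^ w) \<le> real (2 * fact w * (n choose w))"
    by (simp add: binomial_gbinomial)
  then show ?thesis by (simp only: of_nat_le_iff)
qed

context adjacency
begin

definition two_colourable :: "'a set \<Rightarrow> bool" where
  "two_colourable S \<longleftrightarrow> (\<exists>c. mono_pairs c S = {})"

lemma two_colourable_subset: "two_colourable S \<Longrightarrow> T \<subseteq> S \<Longrightarrow> two_colourable T"
proof -
  assume "two_colourable S" and T: "T \<subseteq> S"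
  then obtain c where "mono_pairs c S = {}" by (auto simp: two_colourable_def)
  moreover have "mono_pairs c T \<subseteq> mono_pairs c S" using T by (auto simp: mono_pairs_def)
  ultimately show "two_colourable T" by (auto simp: two_colourable_def)
qed

text \<open>A 2-colouring of the sample \<^term>\<open>set xs\<close> forces the colours of the remaining vertices
  adjacent to it.  Whatever the colouring, this forced colouring has many monochromatic pairs, and a
  second sample containing one of them shows that the colouring of \<^term>\<open>set xs\<close> does not extend.\<close>
context
  fixes V :: "'a set" and k :: nat
  assumes fin: "finite V" and V_nonempty: "V \<noteq> {}" and k: "k > 0"
    and far: "\<And>c. (card V)\<^sup>2 \<le> k * card (mono_pairs c V)"
begin

definition neighbours :: "'a \<Rightarrow> 'a set" where
  "neighbours v = {x \<in> V. adj v x}"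

text \<open>Only vertices of large degree are likely to have a sampled neighbour. With the factor 4,
  the ordered pairs meeting the other vertices are at most half of those guaranteed by
  \<open>far\<close>.\<close>

definition high :: "'a set" where
  "high = {v \<in> V. card V \<le> 4 * k * card (neighbours v)}"

definition uncovered :: "'a list \<Rightarrow> 'a set" where
  "uncovered xs = {v \<in> high. set xs \<inter> neighbours v = {}}"

text \<open>\<open>A\<close> stands for the sampled vertices of colour \<open>True\<close>. A vertex
  adjacent to \<open>A\<close> must be \<open>False\<close>; \<open>True\<close> is the default,
  also for vertices without sampled neighbours.\<close>

definition forced :: "'a set \<Rightarrow> 'a \<Rightarrow> bool" where
  "forced A v \<longleftrightarrow> \<not> (\<exists>x\<in>A. adj v x)"

definition violated :: "'a list \<Rightarrow> 'a set \<Rightarrow> ('a \<times> 'a) set" where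
  "violated xs A = {(u, v) \<in> mono_pairs (forced A) V. u \<in> high - uncovered xs \<and> v \<in> high - uncovered xs}"

text \<open>Let n = \<open>card V\<close>. Multiplied by 4k, the monochromatic pairs of the forced
  colouring number at least 4n^2. Those with an end outside \<open>high\<close> take at most n^2 in
  each order and those with an uncovered end at most n^2 altogether, so n^2 remain.\<close>

lemma card_violated:
  assumes "8 * k * card (uncovered xs) \<le> card V"
  shows "(card V)\<^sup>2 \<le> 4 * k * card (violated xs A)"
proof -
  let ?n = "card V" and ?L = "V - high" and ?U = "uncovered xs"
  have sub: "?L \<subseteq> V" "?U \<subseteq> V" by (auto simp: uncovered_def high_def)
  have finU: "finite ?U" using sub fin finite_subset by blast
  have "mono_pairs (forced A) V \<subseteq> violated xs A \<union> (crossing ?L V \<union> (crossing V ?L \<union> (?U \<times> V \<union> V \<times> ?U)))"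
    by (auto simp: violated_def mono_pairs_def crossing_def)
  then have "card (mono_pairs (forced A) V) \<le>
      card (violated xs A \<union> (crossing ?L V \<union> (crossing V ?L \<union> (?U \<times> V \<union> V \<times> ?U))))"
    using fin finU finite_subset[OF _ finite_mono_pairs[OF fin], of "violated xs A" "forced A"]
    by (intro card_mono) (auto intro!: finite_crossing simp: violated_def)
  also have "\<dots> \<le> card (violated xs A) + (card (crossing ?L V) + (card (crossing V ?L) +
      (card (?U \<times> V) + card (V \<times> ?U))))"
    by (intro order.trans[OF card_Un_le] add_mono order.refl)
  also have "\<dots> = card (violated xs A) + 2 * card (crossing ?L V) + 2 * (?n * card ?U)"
    using card_crossing_commute[of V ?L] by (simp add: card_cartesian_product)
  finally have "4 * k * card (mono_pairs (forced A) V) \<le>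
      4 * k * (card (violated xs A) + 2 * card (crossing ?L V) + 2 * (?n * card ?U))"
    by (rule mult_le_mono2)
  also have "\<dots> = 4 * k * card (violated xs A) + 2 * (4 * k * card (crossing ?L V)) +
      ?n * (8 * k * card ?U)"
    by (simp add: algebra_simps)
  also have "4 * k * card (crossing ?L V) \<le> ?n * ?n"
  proof -
    have "crossing ?L V = (SIGMA u:?L. neighbours u)"
      by (auto simp: crossing_def neighbours_def)
    then have "4 * k * card (crossing ?L V) = (\<Sum>u\<in>?L. 4 * k * card (neighbours u))"
      using fin by (simp add: card_SigmaI neighbours_def sum_distrib_left)
    also have "\<dots> \<le> (\<Sum>u\<in>?L. ?n)" by (intro sum_mono) (auto simp: high_def)
    also have "\<dots> \<le> ?n * ?n" using fin by (simp add: card_mono)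
    finally show ?thesis .
  qed
  also have "?n * (8 * k * card ?U) \<le> ?n * ?n" using assms by (rule mult_le_mono2)
  finally have "4 * k * card (mono_pairs (forced A) V) \<le> 4 * k * card (violated xs A) + 3 * (?n * ?n)"
    by simp
  moreover have "4 * (?n * ?n) \<le> 4 * k * card (mono_pairs (forced A) V)"
    using mult_le_mono2[OF far[of "forced A"], of 4] by (simp add: power2_eq_square mult.assoc)
  ultimately show ?thesis unfolding power2_eq_square by linarith
qed

text \<open>A covered \<open>v\<close> has a sampled neighbour, and all its sampled neighbours have
  the colour opposite to \<open>c v\<close>; so some of them has colour \<open>True\<close> exactly
  if \<open>c v\<close> is \<open>False\<close>.\<close>

lemma forced_colour:
  assumes c: "mono_pairs c (set xs \<union> S) = {}" and v: "v \<in> S" "v \<in> high - uncovered xs"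
  shows "forced {x \<in> set xs. c x} v = c v"
proof -
  obtain x where x: "x \<in> set xs" "adj v x"
    using v(2) by (auto simp: uncovered_def neighbours_def)
  have "c v \<noteq> c y" if "y \<in> set xs" "adj v y" for y
    using c v(1) that unfolding mono_pairs_def by blast
  then show ?thesis using x unfolding forced_def by blast
qed

lemma violated_pair_not_sampled:
  assumes c: "mono_pairs c (set xs \<union> S) = {}" and S: "u \<in> S" "v \<in> S"
  shows "(u, v) \<notin> violated xs {x \<in> set xs. c x}"
proof
  assume *: "(u, v) \<in> violated xs {x \<in> set xs. c x}"
  then have "c u = c v"
    using forced_colour[OF c S(1)] forced_colour[OF c S(2)]
    by (auto simp: violated_def mono_pairs_def)
  moreover have "adj u v" using * by (auto simp: violated_def mono_pairs_def)
  ultimately show False using c S unfolding mono_pairs_def by blast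
qed

text \<open>A vertex of \<open>high\<close> is missed with probability at most (1 - 1/(4k))^a \<le>
  exp(-320k). By Markov's inequality the exceptional samples have probability at most 8k exp(-320k).
  The value of \<open>a\<close> is chosen so that x exp(-x) \<le> 1 at x = 320k turns this into
  1/40.\<close>

lemma card_mostly_uncovered:
  fixes a :: nat
  assumes a: "a = 1280 * k\<^sup>2"
  shows "40 * card {xs. set xs \<subseteq> V \<and> length xs = a \<and> card V < 8 * k * card (uncovered xs)} \<le> card V ^ a"
proof -
  let ?n = "card V"
  let ?Ls = "{xs. set xs \<subseteq> V \<and> length xs = a}"
  let ?B = "{xs. set xs \<subseteq> V \<and> length xs = a \<and> card V < 8 * k * card (uncovered xs)}"
  have n: "?n > 0" using fin V_nonempty by (simp add: card_gt_0_iff)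
  have finLs: "finite ?Ls" using finite_lists_length_eq[OF fin] .
  have finH: "finite high" using fin by (simp add: high_def)
  have "real (card {xs \<in> ?Ls. set xs \<inter> neighbours v = {}}) \<le> real ?n ^ a * exp (- (320 * real k))"
    if v: "v \<in> high" for v
  proof -
    let ?N = "neighbours v"
    have N: "?N \<subseteq> V" "finite ?N" using fin by (auto simp: neighbours_def)
    have "{xs \<in> ?Ls. set xs \<inter> ?N = {}} = {xs. set xs \<subseteq> V - ?N \<and> length xs = a}" by auto
    then have "card {xs \<in> ?Ls. set xs \<inter> ?N = {}} = (?n - card ?N) ^ a"
      using fin N by (simp add: card_lists_length_eq card_Diff_subset)
    then have "real (card {xs \<in> ?Ls. set xs \<inter> ?N = {}}) = (real ?n - card ?N) ^ a"
      using card_mono[OF fin N(1)] by (simp add: of_nat_diff)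
    also have "\<dots> \<le> (real ?n * (1 - 1 / (4 * k))) ^ a"
    proof (rule power_mono)
      have "real ?n \<le> real (4 * k * card ?N)"
        using v unfolding high_def of_nat_le_iff by simp
      then show "real ?n - card ?N \<le> real ?n * (1 - 1 / (4 * k))"
        using k by (simp add: field_simps)
      show "0 \<le> real ?n - card ?N" using card_mono[OF fin N(1)] by simp
    qed
    also have "\<dots> = real ?n ^ a * (1 - 1 / (4 * k)) ^ a" by (rule power_mult_distrib)
    also have "\<dots> \<le> real ?n ^ a * exp (- (real a * (1 / (4 * k))))"
      using k by (intro mult_left_mono power_one_minus_le_exp) auto
    also have "real a * (1 / (4 * k)) = 320 * real k"
      using k by (simp add: a power2_eq_square)
    finally show ?thesis by simp
  qed
  note prob = this
  have "real (\<Sum>xs\<in>?Ls. card (uncovered xs)) =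
      (\<Sum>v\<in>high. real (card {xs \<in> ?Ls. set xs \<inter> neighbours v = {}}))"
    unfolding uncovered_def
    by (subst sum_multicount_gen[OF finLs finH, of "\<lambda>xs v. set xs \<inter> neighbours v = {}"]) auto
  also have "\<dots> \<le> (\<Sum>v\<in>high. real ?n ^ a * exp (- (320 * real k)))"
    by (intro sum_mono prob)
  also have "\<dots> = card high * (real ?n ^ a * exp (- (320 * real k)))" by simp
  also have "\<dots> \<le> ?n * (real ?n ^ a * exp (- (320 * real k)))"
    using fin by (intro mult_right_mono of_nat_mono card_mono) (auto simp: high_def)
  finally have expect: "real (\<Sum>xs\<in>?Ls. card (uncovered xs)) \<le> ?n * (real ?n ^ a * exp (- (320 * real k)))" .
  have "real (card ?B * ?n) = (\<Sum>xs\<in>?B. real ?n)" by simp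
  also have "\<dots> \<le> (\<Sum>xs\<in>?B. real (8 * k * card (uncovered xs)))"
    by (intro sum_mono of_nat_mono) auto
  also have "\<dots> \<le> (\<Sum>xs\<in>?Ls. real (8 * k * card (uncovered xs)))"
    using finLs by (intro sum_mono2) auto
  also have "\<dots> = 8 * k * real (\<Sum>xs\<in>?Ls. card (uncovered xs))" by (simp add: sum_distrib_left)
  also have "\<dots> \<le> 8 * k * (?n * (real ?n ^ a * exp (- (320 * real k))))"
    using expect by (intro mult_left_mono) auto
  finally have "real (card ?B) * ?n \<le> (8 * k * (real ?n ^ a * exp (- (320 * real k)))) * ?n"
    by (simp add: algebra_simps)
  then have "real (card ?B) \<le> 8 * k * (real ?n ^ a * exp (- (320 * real k)))" using n by simp
  then have "40 * real (card ?B) \<le> real ?n ^ a * (real (320 * k) * exp (- (320 * real k)))" by simp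
  also have "\<dots> \<le> real ?n ^ a * 1"
  proof (rule mult_left_mono)
    have "320 * real k \<le> exp (320 * real k)" using exp_ge_add_one_self[of "320 * real k"] by linarith
    then show "real (320 * k) * exp (- (320 * real k)) \<le> 1" by (simp add: exp_minus field_simps)
  qed simp
  finally have "40 * real (card ?B) \<le> real ?n ^ a" by simp
  then have "real (40 * card ?B) \<le> real (?n ^ a)" by simp
  then show ?thesis by (simp only: of_nat_le_iff)
qed

text \<open>A fixed colouring of \<open>xs\<close> survives \<open>b\<close> independent pairs with
  probability at most (1 - 1/(4k))^b \<le> exp(-(a + 40)). The union bound over at most 2^a \<le>
  exp(a) colourings leaves exp(-40), which is below 1/40. Pairs are sampled rather than vertices
  because a violation is a property of a pair.\<close>

lemma card_colourable_extensions:
  assumes xs: "set xs \<subseteq> V" "8 * k * card (uncovered xs) \<le> card V"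
    and a: "length xs = a" and b: "b = 4 * k * (a + 40)"
  shows "40 * card {zs. set zs \<subseteq> V \<times> V \<and> length zs = b \<and>
    two_colourable (set xs \<union> (fst ` set zs \<union> snd ` set zs))} \<le> card V ^ (2 * b)"
proof -
  let ?n = "card V"
  let ?Z = "{zs. set zs \<subseteq> V \<times> V \<and> length zs = b \<and> two_colourable (set xs \<union> (fst ` set zs \<union> snd ` set zs))}"
  define Y where "Y A = {zs. set zs \<subseteq> V \<times> V - violated xs A \<and> length zs = b}" for A
  have finV2: "finite (V \<times> V)" using fin by simp
  have n: "?n > 0" using fin V_nonempty by (simp add: card_gt_0_iff)
  have Y: "finite (Y A)" "real (card (Y A)) \<le> real ?n ^ (2 * b) * exp (- (real a + 40))" for A
  proof -
    show "finite (Y A)" unfolding Y_def using finV2 by (intro finite_lists_length_eq) auto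
    have vio: "violated xs A \<subseteq> V \<times> V" by (auto simp: violated_def mono_pairs_def)
    then have "card (Y A) = (?n * ?n - card (violated xs A)) ^ b"
      unfolding Y_def using finV2 finite_subset[OF vio finV2]
      by (simp add: card_lists_length_eq card_Diff_subset card_cartesian_product)
    moreover have le: "card (violated xs A) \<le> ?n * ?n"
      using card_mono[OF finV2 vio] by (simp add: card_cartesian_product)
    ultimately have "real (card (Y A)) = (real ?n * ?n - card (violated xs A)) ^ b"
      by (simp add: of_nat_diff)
    also have "\<dots> \<le> (real ?n * ?n * (1 - 1 / (4 * k))) ^ b"
    proof (rule power_mono)
      have "real (?n * ?n) \<le> real (4 * k * card (violated xs A))"
        using card_violated[OF xs(2), of A] unfolding of_nat_le_iff power2_eq_square .
      then show "real ?n * ?n - card (violated xs A) \<le> real ?n * ?n * (1 - 1 / (4 * k))"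
        using k by (simp add: field_simps)
      show "0 \<le> real ?n * ?n - card (violated xs A)"
        using of_nat_mono[OF le, where 'a = real] by simp
    qed
    also have "\<dots> = real ?n ^ (2 * b) * (1 - 1 / (4 * k)) ^ b"
      by (simp only: power_mult_distrib power_mult power2_eq_square)
    also have "\<dots> \<le> real ?n ^ (2 * b) * exp (- (real b * (1 / (4 * k))))"
      using k by (intro mult_left_mono power_one_minus_le_exp) auto
    also have "real b * (1 / (4 * k)) = real a + 40" using k by (simp add: b)
    finally show "real (card (Y A)) \<le> real ?n ^ (2 * b) * exp (- (real a + 40))" by simp
  qed
  have "?Z \<subseteq> (\<Union>A\<in>Pow (set xs). Y A)"
  proof
    fix zs assume zs: "zs \<in> ?Z"
    then obtain c where c: "mono_pairs c (set xs \<union> (fst ` set zs \<union> snd ` set zs)) = {}"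
      by (auto simp: two_colourable_def)
    have "e \<notin> violated xs {x \<in> set xs. c x}" if "e \<in> set zs" for e
      using violated_pair_not_sampled[OF c, of "fst e" "snd e"] that by auto
    then have "zs \<in> Y {x \<in> set xs. c x}" using zs by (auto simp: Y_def)
    then show "zs \<in> (\<Union>A\<in>Pow (set xs). Y A)" by (rule UN_I[rotated]) auto
  qed
  then have "card ?Z \<le> card (\<Union>A\<in>Pow (set xs). Y A)" using Y(1) by (intro card_mono) auto
  also have "\<dots> \<le> (\<Sum>A\<in>Pow (set xs). card (Y A))" by (intro card_UN_le) auto
  finally have "real (card ?Z) \<le> real (\<Sum>A\<in>Pow (set xs). card (Y A))" by (rule of_nat_mono)
  also have "\<dots> \<le> (\<Sum>A\<in>Pow (set xs). real ?n ^ (2 * b) * exp (- (real a + 40)))"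
    unfolding of_nat_sum by (intro sum_mono Y(2))
  also have "\<dots> = 2 ^ card (set xs) * (real ?n ^ (2 * b) * exp (- (real a + 40)))" by (simp add: card_Pow)
  also have "\<dots> \<le> exp a * (real ?n ^ (2 * b) * exp (- (real a + 40)))"
  proof (rule mult_right_mono)
    have "(2 :: real) ^ card (set xs) \<le> 2 ^ a" using card_length[of xs] a by (intro power_increasing) auto
    also have "\<dots> \<le> exp 1 ^ a" using exp_ge_add_one_self[of 1] by (intro power_mono) auto
    also have "\<dots> = exp a" by (simp flip: exp_of_nat_mult)
    finally show "(2 :: real) ^ card (set xs) \<le> exp a" .
  qed simp
  also have "exp a * (real ?n ^ (2 * b) * exp (- (real a + 40))) = real ?n ^ (2 * b) * (exp a * exp (- (real a + 40)))"
    by simp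
  also have "exp (real a) * exp (- (real a + 40)) = exp (- 40)" by (simp flip: exp_add)
  finally have "40 * real (card ?Z) \<le> real ?n ^ (2 * b) * (40 * exp (- 40))" by simp
  also have "\<dots> \<le> real ?n ^ (2 * b) * 1"
  proof (rule mult_left_mono)
    have "40 \<le> exp (40 :: real)" using exp_ge_add_one_self[of 40] by linarith
    then show "40 * exp (- 40 :: real) \<le> 1" by (simp add: exp_minus field_simps)
  qed simp
  finally have "real (40 * card ?Z) \<le> real (?n ^ (2 * b))" by simp
  then show ?thesis by (simp only: of_nat_le_iff)
qed

definition colourable_samples :: "nat \<Rightarrow> nat \<Rightarrow> ('a list \<times> ('a \<times> 'a) list) set" where
  "colourable_samples a b = {(xs, zs). set xs \<subseteq> V \<and> length xs = a \<and> set zs \<subseteq> V \<times> V \<and> length zs = b \<and>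
    two_colourable (set xs \<union> (fst ` set zs \<union> snd ` set zs))}"

text \<open>The two kinds of failure, a first sample leaving too much uncovered and a second one
  missing all violations, have probability at most 1/40 each.\<close>

lemma card_colourable_samples:
  assumes a: "a = 1280 * k\<^sup>2" and b: "b = 4 * k * (a + 40)"
  shows "finite (colourable_samples a b)"
    and "20 * card (colourable_samples a b) \<le> card V ^ (a + 2 * b)"
proof -
  let ?T = "colourable_samples a b"
  let ?n = "card V"
  let ?Bad = "{xs. set xs \<subseteq> V \<and> length xs = a \<and> card V < 8 * k * card (uncovered xs)}"
  let ?Ls = "{xs. set xs \<subseteq> V \<and> length xs = a}"
  let ?Zs = "{zs. set zs \<subseteq> V \<times> V \<and> length zs = b}"
  define Z where "Z xs = {zs. set zs \<subseteq> V \<times> V \<and> length zs = b \<and>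
    two_colourable (set xs \<union> (fst ` set zs \<union> snd ` set zs))}" for xs
  have finZs: "finite ?Zs" and cardZs: "card ?Zs = ?n ^ (2 * b)"
    using finite_lists_length_eq[of "V \<times> V" b] card_lists_length_eq[of "V \<times> V" b] fin
    by (auto simp: card_cartesian_product power_mult power2_eq_square)
  have finLs: "finite ?Ls" and cardLs: "card ?Ls = ?n ^ a"
    using finite_lists_length_eq[OF fin] card_lists_length_eq[OF fin] by auto
  have finZ: "finite (Z xs)" for xs by (rule finite_subset[OF _ finZs]) (auto simp: Z_def)
  have T: "?T \<subseteq> ?Bad \<times> ?Zs \<union> (SIGMA xs:?Ls - ?Bad. Z xs)" by (auto simp: Z_def colourable_samples_def)
  have finB: "finite ?Bad" by (rule finite_subset[OF _ finLs]) auto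
  have finT: "finite (?Bad \<times> ?Zs \<union> (SIGMA xs:?Ls - ?Bad. Z xs))"
    using finB finZs finZ finLs by auto
  show "finite ?T" using T finT by (rule finite_subset)
  have "card ?T \<le> card (?Bad \<times> ?Zs \<union> (SIGMA xs:?Ls - ?Bad. Z xs))"
    using T finT by (rule card_mono[rotated])
  also have "\<dots> \<le> card (?Bad \<times> ?Zs) + card (SIGMA xs:?Ls - ?Bad. Z xs)" by (rule card_Un_le)
  also have "\<dots> = card ?Bad * ?n ^ (2 * b) + (\<Sum>xs\<in>?Ls - ?Bad. card (Z xs))"
    using finLs finZ by (simp add: card_cartesian_product cardZs card_SigmaI)
  finally have "40 * card ?T \<le> 40 * card ?Bad * ?n ^ (2 * b) + (\<Sum>xs\<in>?Ls - ?Bad. 40 * card (Z xs))"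
    by (simp add: sum_distrib_left[symmetric])
  also have "40 * card ?Bad * ?n ^ (2 * b) \<le> ?n ^ a * ?n ^ (2 * b)"
    using card_mostly_uncovered[OF a] by (rule mult_le_mono1)
  also have "(\<Sum>xs\<in>?Ls - ?Bad. 40 * card (Z xs)) \<le> (\<Sum>xs\<in>?Ls - ?Bad. ?n ^ (2 * b))"
    unfolding Z_def using b by (intro sum_mono card_colourable_extensions) auto
  also have "\<dots> \<le> (\<Sum>xs\<in>?Ls. ?n ^ (2 * b))"
    using finLs by (intro sum_mono2) auto
  also have "\<dots> = ?n ^ a * ?n ^ (2 * b)" by (simp add: cardLs)
  finally show "20 * card ?T \<le> ?n ^ (a + 2 * b)" by (simp add: power_add)
qed

text \<open>Each 2-colourable \<open>w\<close>-set yields \<open>fact w\<close> different colourable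
  samples, one for each ordering. Their proportion 1/20 among all tuples at most doubles when only
  tuples without repetition are counted.\<close>

lemma card_colourable_subsets:
  assumes a: "a = 1280 * k\<^sup>2" and b: "b = 4 * k * (a + 40)" and w: "w = a + 2 * b"
    and n: "2 * w\<^sup>2 \<le> card V"
  shows "10 * card {S. S \<subseteq> V \<and> card S = w \<and> two_colourable S} \<le> card V choose w"
proof -
  let ?n = "card V"
  let ?X = "{S. S \<subseteq> V \<and> card S = w \<and> two_colourable S}"
  let ?T = "colourable_samples a b"
  let ?D = "\<Union>S\<in>?X. permutations_of_set S"
  \<comment> \<open>An ordering is cut into a first sample of \<open>a\<close> vertices and two
    blocks of length \<open>b\<close>, whose entries are paired; on lists of length \<open>w\<close>
    this can be undone.\<close>
  let ?g = "\<lambda>L. (take a L, zip (take b (drop a L)) (drop (a + b) L))"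
  have finX: "finite ?X" by (rule finite_subset[of _ "Pow V"]) (use fin in auto)
  have finS: "finite S" if "S \<in> ?X" for S using that fin finite_subset by blast
  have "card ?D = (\<Sum>S\<in>?X. card (permutations_of_set S))"
  proof (rule card_UN_disjoint[OF finX])
    show "\<forall>S\<in>?X. finite (permutations_of_set S)" by simp
    show "\<forall>S\<in>?X. \<forall>S'\<in>?X. S \<noteq> S' \<longrightarrow> permutations_of_set S \<inter> permutations_of_set S' = {}"
      by (auto simp: permutations_of_set_def)
  qed
  also have "\<dots> = (\<Sum>S\<in>?X. fact w)" using finS by (intro sum.cong) auto
  finally have cardD: "card ?D = card ?X * fact w" by simp
  have D: "length L = w \<and> set L \<subseteq> V \<and> two_colourable (set L)" if "L \<in> ?D" for L
    using that by (auto simp: permutations_of_set_def distinct_card[symmetric])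
  have "inj_on ?g ?D"
  proof (rule inj_onI)
    fix L M assume L: "L \<in> ?D" and M: "M \<in> ?D" and eq: "?g L = ?g M"
    have lens: "length (take b (drop a L)) = length (drop (a + b) L)"
        "length (take b (drop a M)) = length (drop (a + b) M)"
      using D[OF L] D[OF M] w by auto
    have zip: "zip (take b (drop a L)) (drop (a + b) L) = zip (take b (drop a M)) (drop (a + b) M)"
      and "take a L = take a M"
      using eq by auto
    moreover have "take b (drop a L) = take b (drop a M)"
      using arg_cong[OF zip, of "map fst"] lens by simp
    moreover have "drop (a + b) L = drop (a + b) M"
      using arg_cong[OF zip, of "map snd"] lens by simp
    ultimately have "take a L @ take b (drop a L) @ drop (a + b) L =
        take a M @ take b (drop a M) @ drop (a + b) M" by simp
    moreover have "take a L @ take b (drop a L) @ drop (a + b) L = L" for L :: "'a list"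
      by (metis append_take_drop_id drop_drop add.commute)
    ultimately show "L = M" by metis
  qed
  moreover have "?g ` ?D \<subseteq> ?T"
  proof
    fix p assume "p \<in> ?g ` ?D"
    then obtain L where L: "L \<in> ?D" "p = ?g L" by blast
    let ?zs = "zip (take b (drop a L)) (drop (a + b) L)"
    have 1: "set (take a L) \<subseteq> set L" by (rule set_take_subset)
    have "set ?zs \<subseteq> set (take b (drop a L)) \<times> set (drop (a + b) L)"
      by (auto dest: set_zip_leftD set_zip_rightD)
    also have "\<dots> \<subseteq> set L \<times> set L"
      by (intro Sigma_mono) (auto dest: in_set_takeD in_set_dropD)
    finally have 2: "set ?zs \<subseteq> set L \<times> set L" .
    have "two_colourable (set (take a L) \<union> (fst ` set ?zs \<union> snd ` set ?zs))"
    proof (rule two_colourable_subset)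
      show "two_colourable (set L)" using D[OF L(1)] by blast
      show "set (take a L) \<union> (fst ` set ?zs \<union> snd ` set ?zs) \<subseteq> set L" using 1 2 by fastforce
    qed
    moreover have "set ?zs \<subseteq> V \<times> V" using 2 D[OF L(1)] by blast
    ultimately show "p \<in> ?T" using D[OF L(1)] 1 w L(2) by (auto simp: colourable_samples_def)
  qed
  ultimately have "card ?D \<le> card ?T"
    using card_colourable_samples(1)[OF a b] by (rule card_inj_on_le)
  then have "card ?X * fact w \<le> card ?T" unfolding cardD .
  then have "20 * (card ?X * fact w) \<le> ?n ^ w"
    using card_colourable_samples(2)[OF a b] unfolding w by linarith
  also have "\<dots> \<le> 2 * fact w * (?n choose w)"
    using n fin V_nonempty by (intro power_le_fact_mult_binomial) (auto simp: card_gt_0_iff)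
  finally have "(2 * fact w) * (10 * card ?X) \<le> (2 * fact w) * (?n choose w)"
    by (simp add: algebra_simps)
  then show ?thesis by simp
qed

end

end

section \<open>From small 2-colourable subsets to large samples far from bipartite\<close>

context adjacency
begin

text \<open>A given pair lies in a random \<open>w\<close>-subset of \<open>S\<close> with
  probability at most 2w^2/q^2. So the expected number of monochromatic pairs inside is at most 1/2,
  and a subset with none is properly coloured by \<open>c\<close>.\<close>

lemma many_colourable_subsets:
  assumes S: "finite S" "card S = q" and w: "2 \<le> w" "w \<le> q"
    and few: "card (mono_pairs c S) * (4 * w\<^sup>2) < q\<^sup>2"
  shows "q choose w \<le> 2 * card {T. T \<subseteq> S \<and> card T = w \<and> two_colourable T}"
proof -
  let ?M = "mono_pairs c S"
  let ?W = "{T. T \<subseteq> S \<and> card T = w}"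
  define hit where "hit = (\<lambda>(u, v). {T \<in> ?W. u \<in> T \<and> v \<in> T})"
  have finW: "finite ?W" by (rule finite_subset[of _ "Pow S"]) (use S in auto)
  have finM: "finite ?M" using S(1) by (rule finite_mono_pairs)
  have hit: "finite (hit e)" "card (hit e) \<le> (q - 2) choose (w - 2)" if M: "e \<in> ?M" for e
  proof -
    obtain u v where e: "e = (u, v)" "u \<in> S" "v \<in> S" and "adj u v"
      using M by (cases e) (auto simp: mono_pairs_def)
    then have "u \<noteq> v" using adj_irrefl by blast
    show "finite (hit e)" by (rule finite_subset[OF _ finW]) (auto simp: hit_def e)
    have "inj_on (\<lambda>T. T - {u, v}) (hit e)"
      by (rule inj_onI) (auto simp: hit_def e)
    moreover have "(\<lambda>T. T - {u, v}) ` hit e \<subseteq> {B. B \<subseteq> S - {u, v} \<and> card B = w - 2}"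
    proof
      fix B assume "B \<in> (\<lambda>T. T - {u, v}) ` hit e"
      then obtain T where T: "T \<in> ?W" "{u, v} \<subseteq> T" "B = T - {u, v}" by (auto simp: hit_def e)
      then have "card B = w - 2"
        using card_Diff_subset[of "{u, v}" T] \<open>u \<noteq> v\<close> by auto
      then show "B \<in> {B. B \<subseteq> S - {u, v} \<and> card B = w - 2}" using T by auto
    qed
    moreover have "finite {B. B \<subseteq> S - {u, v} \<and> card B = w - 2}"
      by (rule finite_subset[of _ "Pow S"]) (use S in auto)
    ultimately have "card (hit e) \<le> card {B. B \<subseteq> S - {u, v} \<and> card B = w - 2}"
      by (rule card_inj_on_le)
    also have "\<dots> = card (S - {u, v}) choose (w - 2)" using S by (intro n_subsets) auto
    also have "card (S - {u, v}) = q - 2" using card_Diff_subset[of "{u, v}" S] e \<open>u \<noteq> v\<close> S by auto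
    finally show "card (hit e) \<le> (q - 2) choose (w - 2)" .
  qed
  let ?C = "{T. T \<subseteq> S \<and> card T = w \<and> two_colourable T}"
  have "?W \<subseteq> ?C \<union> (\<Union>e\<in>?M. hit e)"
  proof
    fix T assume T: "T \<in> ?W"
    show "T \<in> ?C \<union> (\<Union>e\<in>?M. hit e)"
    proof (cases "mono_pairs c T = {}")
      case True
      then show ?thesis using T by (auto simp: two_colourable_def)
    next
      case False
      then obtain u v where uv: "(u, v) \<in> mono_pairs c T" by auto
      then have "(u, v) \<in> ?M" "T \<in> hit (u, v)" using T by (auto simp: mono_pairs_def hit_def)
      then show ?thesis by blast
    qed
  qed
  moreover have finC: "finite ?C" by (rule finite_subset[OF _ finW]) auto
  ultimately have "card ?W \<le> card (?C \<union> (\<Union>e\<in>?M. hit e))"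
    using finM hit(1) by (intro card_mono) auto
  also have "\<dots> \<le> card ?C + card (\<Union>e\<in>?M. hit e)" by (rule card_Un_le)
  also have "card (\<Union>e\<in>?M. hit e) \<le> (\<Sum>e\<in>?M. card (hit e))" using finM by (rule card_UN_le)
  also have "\<dots> \<le> (\<Sum>e\<in>?M. (q - 2) choose (w - 2))" using hit(2) by (rule sum_mono)
  also have "\<dots> = card ?M * ((q - 2) choose (w - 2))" by simp
  also have "card ?W = q choose w" using n_subsets[OF S(1), of w] S(2) by simp
  finally have main: "q choose w \<le> card ?C + card ?M * ((q - 2) choose (w - 2))" by simp
  have q: "q \<ge> 2" using w by simp
  have "w * (q choose w) = q * ((q - 1) choose (w - 1))"
    using w by (intro times_binomial_minus1_eq) simp
  moreover have "(w - 1) * ((q - 1) choose (w - 1)) = (q - 1) * ((q - 2) choose (w - 2))"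
    using times_binomial_minus1_eq[of "w - 1" "q - 1"] w by (simp add: numeral_2_eq_2)
  ultimately have "q * (q - 1) * ((q - 2) choose (w - 2)) = (w - 1) * (w * (q choose w))"
    by (metis mult.assoc mult.left_commute)
  also have "\<dots> \<le> w * (w * (q choose w))" by (rule mult_le_mono1) simp
  finally have "q * (q - 1) * ((q - 2) choose (w - 2)) \<le> w\<^sup>2 * (q choose w)"
    by (simp add: power2_eq_square mult.assoc)
  moreover have "q\<^sup>2 \<le> 2 * (q * (q - 1))" using q by (cases q) (auto simp: power2_eq_square)
  then have "q\<^sup>2 * ((q - 2) choose (w - 2)) \<le> 2 * (q * (q - 1)) * ((q - 2) choose (w - 2))"
    by (rule mult_le_mono1)
  ultimately have binom: "q\<^sup>2 * ((q - 2) choose (w - 2)) \<le> 2 * w\<^sup>2 * (q choose w)"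
    by linarith
  have "q\<^sup>2 * (2 * (card ?M * ((q - 2) choose (w - 2)))) =
      2 * card ?M * (q\<^sup>2 * ((q - 2) choose (w - 2)))" by simp
  also have "\<dots> \<le> 2 * card ?M * (2 * w\<^sup>2 * (q choose w))" using binom by (rule mult_le_mono2)
  also have "\<dots> = card ?M * (4 * w\<^sup>2) * (q choose w)" by simp
  also have "\<dots> \<le> q\<^sup>2 * (q choose w)" using few by (intro mult_le_mono1) simp
  finally have "2 * (card ?M * ((q - 2) choose (w - 2))) \<le> q choose w" using q by simp
  then show ?thesis using main by linarith
qed

text \<open>Inclusions of \<open>w\<close>-sets in exceptional \<open>q\<close>-sets are counted
  twice. At least half of the \<open>w\<close>-subsets of an exceptional set are 2-colourable, but
  at most a tenth of all \<open>w\<close>-sets are, so at most a fifth of the \<open>q\<close>-sets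
  are exceptional.\<close>

lemma card_subsets_few_mono_pairs:
  assumes V: "finite V" and w: "2 \<le> w" "w \<le> q" "q \<le> card V"
    and test: "10 * card {T. T \<subseteq> V \<and> card T = w \<and> two_colourable T} \<le> card V choose w"
  shows "5 * card {S. S \<subseteq> V \<and> card S = q \<and> (\<exists>c. card (mono_pairs c S) * (4 * w\<^sup>2) < q\<^sup>2)} \<le> card V choose q"
proof -
  let ?n = "card V"
  let ?B = "{S. S \<subseteq> V \<and> card S = q \<and> (\<exists>c. card (mono_pairs c S) * (4 * w\<^sup>2) < q\<^sup>2)}"
  let ?X = "{T. T \<subseteq> V \<and> card T = w \<and> two_colourable T}"
  have finB: "finite ?B" and finX: "finite ?X"
    by (rule finite_subset[of _ "Pow V"], use V in auto)+
  have "card ?B * (q choose w) = (\<Sum>S\<in>?B. q choose w)" by simp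
  also have "\<dots> \<le> (\<Sum>S\<in>?B. 2 * card {T \<in> ?X. T \<subseteq> S})"
  proof (rule sum_mono)
    fix S assume S: "S \<in> ?B"
    then obtain c where c: "card (mono_pairs c S) * (4 * w\<^sup>2) < q\<^sup>2" by blast
    have "finite S" using S V finite_subset by blast
    then have "q choose w \<le> 2 * card {T. T \<subseteq> S \<and> card T = w \<and> two_colourable T}"
      using S w c by (intro many_colourable_subsets) auto
    also have "{T. T \<subseteq> S \<and> card T = w \<and> two_colourable T} = {T \<in> ?X. T \<subseteq> S}" using S by auto
    finally show "q choose w \<le> 2 * card {T \<in> ?X. T \<subseteq> S}" .
  qed
  also have "\<dots> = 2 * (\<Sum>S\<in>?B. card {T \<in> ?X. T \<subseteq> S})" by (simp add: sum_distrib_left)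
  finally have "card ?B * (q choose w) \<le> 2 * (\<Sum>S\<in>?B. card {T \<in> ?X. T \<subseteq> S})" .
  moreover have "(\<Sum>S\<in>?B. card {T \<in> ?X. T \<subseteq> S}) = (\<Sum>T\<in>?X. card {S \<in> ?B. T \<subseteq> S})"
    using finB finX by (rule sum_multicount_gen) simp
  moreover have "(\<Sum>T\<in>?X. card {S \<in> ?B. T \<subseteq> S}) \<le> (\<Sum>T\<in>?X. (?n - w) choose (q - w))"
  proof (rule sum_mono)
    fix T assume T: "T \<in> ?X"
    have finT: "finite T" using T V finite_subset by blast
    have "inj_on (\<lambda>S. S - T) {S \<in> ?B. T \<subseteq> S}" by (rule inj_onI) blast
    moreover have "(\<lambda>S. S - T) ` {S \<in> ?B. T \<subseteq> S} \<subseteq> {R. R \<subseteq> V - T \<and> card R = q - w}"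
      using T finT by (auto simp: card_Diff_subset)
    moreover have "finite {R. R \<subseteq> V - T \<and> card R = q - w}"
      by (rule finite_subset[of _ "Pow V"]) (use V in auto)
    ultimately have "card {S \<in> ?B. T \<subseteq> S} \<le> card {R. R \<subseteq> V - T \<and> card R = q - w}"
      by (rule card_inj_on_le)
    also have "\<dots> = card (V - T) choose (q - w)" using V by (intro n_subsets) simp
    also have "card (V - T) = ?n - w" using T finT by (simp add: card_Diff_subset)
    finally show "card {S \<in> ?B. T \<subseteq> S} \<le> (?n - w) choose (q - w)" .
  qed
  moreover have "(\<Sum>T\<in>?X. (?n - w) choose (q - w)) = card ?X * ((?n - w) choose (q - w))" by simp
  ultimately have "5 * card ?B * (q choose w) \<le> 10 * card ?X * ((?n - w) choose (q - w))" by linarith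
  also have "\<dots> \<le> (?n choose w) * ((?n - w) choose (q - w))" using test by (rule mult_le_mono1)
  also have "\<dots> = (?n choose q) * (q choose w)" using w by (simp add: choose_mult)
  finally show ?thesis using w(2) by simp
qed

end

text \<open>In a sample that is not exceptional every colouring has at least q^2/(4w^2)
  monochromatic pairs, whence the value of \<open>K\<close>; \<open>mK\<close> and \<open>q\<close>
  then match the range of the cycle lemma for length \<open>m\<close>. The success probability is at
  least 4/5.\<close>

lemma sample_size_suffices_if:
  assumes L: "\<And>s. s \<in> L \<Longrightarrow> odd s" and m: "m \<in> L"
    and \<epsilon>: "1 / real k \<le> \<epsilon>" and k: "k > 0"
    and a: "a = 1280 * k\<^sup>2" and b: "b = 4 * k * (a + 40)" and w: "w = a + 2 * b"
    and K: "K = 4 * w\<^sup>2" and mK: "27 * K \<le> m" and q: "q = 200 * K ^ 3 * m"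
  shows "sample_size_suffices L \<epsilon> q"
  unfolding sample_size_suffices_def
\<comment> \<open>The birthday bound needs 2w^2 vertices, and \<open>q\<close> vertices make sets of
  size \<open>q\<close> available.\<close>
proof (intro exI[of _ "2 * w\<^sup>2 + q"] allI impI)
  fix G :: "nat sgraph"
  assume "finite_simple_graph G \<and> 2 * w\<^sup>2 + q \<le> card (verts G) \<and> far_from_cycles_free \<epsilon> L G"
  then have G: "finite_simple_graph G" and n: "2 * w\<^sup>2 + q \<le> card (verts G)"
    and far: "far_from_cycles_free \<epsilon> L G" by auto
  let ?V = "verts G" and ?n = "card (verts G)"
  have E: "\<And>e. e \<in> edges G \<Longrightarrow> card e = 2" and V: "finite ?V"
    using G by (auto simp: finite_simple_graph_def)
  interpret adjacency "\<lambda>u v. {u, v} \<in> edges G" by (rule adjacency_edges[OF E])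
  have "1 \<le> k\<^sup>2" using k by simp
  then have w2: "w \<ge> 2" unfolding w a by linarith
  have Kpos: "K > 0" using w2 by (simp add: K)
  then have qm: "q > 0" using mK by (simp add: q)
  have wq: "w \<le> q"
  proof -
    have "w \<le> K" using w2 by (simp add: K power2_eq_square)
    also have "\<dots> \<le> m" using mK by simp
    also have "\<dots> \<le> 200 * K ^ 3 * m" using Kpos by simp
    finally show ?thesis by (simp add: q)
  qed
  have V0: "?V \<noteq> {}" using n qm by auto
  have mono: "?n\<^sup>2 \<le> k * card (mono_pairs c ?V)" for c
  proof -
    have "1 / real k * real ?n ^ 2 \<le> \<epsilon> * real ?n ^ 2" using \<epsilon> by (rule mult_right_mono) simp
    also have "\<dots> \<le> card (mono_pairs c ?V)" by (rule mono_pairs_if_far[OF G far L])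
    finally have "real (?n\<^sup>2) \<le> real (k * card (mono_pairs c ?V))" using k by (simp add: field_simps)
    then show ?thesis by (simp only: of_nat_le_iff)
  qed
  have test: "10 * card {T. T \<subseteq> ?V \<and> card T = w \<and> two_colourable T} \<le> ?n choose w"
    using card_colourable_subsets[OF V V0 k mono a b w] n by simp
  let ?A = "{S. S \<subseteq> ?V \<and> card S = q}"
  let ?bad = "{S. S \<subseteq> ?V \<and> card S = q \<and> (\<exists>c. card (mono_pairs c S) * (4 * w\<^sup>2) < q\<^sup>2)}"
  let ?good = "{S. \<not> cycles_free L (induced_subgraph G S)}"
  have bad: "5 * card ?bad \<le> ?n choose q"
    using card_subsets_few_mono_pairs[OF V w2 wq _ test] n by simp
  have cycle: "S \<in> ?good" if S: "S \<in> ?A" "S \<notin> ?bad" for S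
  proof -
    have finS: "finite S" "S \<noteq> {}" using S(1) V qm finite_subset by auto
    have "\<And>c. (card S)\<^sup>2 \<le> card (mono_pairs c S) * K" using S by (auto simp: K not_less)
    then obtain cs where cs: "cyclic cs" "distinct cs" "length cs = m" "set cs \<subseteq> S"
      using cycle_of_length_if_far_bipartite[OF finS Kpos, of m] L[OF m] mK S(1) q by auto
    have E': "\<And>e. e \<in> edges (induced_subgraph G S) \<Longrightarrow> card e = 2"
      using E by (auto simp: induced_subgraph_def)
    interpret I: adjacency "\<lambda>u v. {u, v} \<in> edges (induced_subgraph G S)"
      by (rule adjacency_edges[OF E'])
    have "{cs ! i, cs ! Suc i} \<in> edges (induced_subgraph G S)" if "Suc i < length cs" for i
    proof -
      have "{cs ! i, cs ! Suc i} \<in> edges G"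
        using cs(1) that by (auto simp: cyclic_def successively_conv_nth)
      moreover have "cs ! i \<in> S" "cs ! Suc i \<in> S" using cs(4) that nth_mem by force+
      ultimately show ?thesis by (simp add: induced_subgraph_def)
    qed
    moreover have "{last cs, hd cs} \<in> edges (induced_subgraph G S)"
      using cs(1,4) by (auto simp: cyclic_def induced_subgraph_def)
    ultimately have "I.cyclic cs"
      using cs(1) unfolding I.cyclic_def cyclic_def by (auto simp: successively_conv_nth)
    then have "contains_copy (cycle_graph m) (induced_subgraph G S)"
      using contains_copy_if_cyclic[of "induced_subgraph G S" cs, OF E'] cs S(1)
      by (auto simp: induced_subgraph_def)
    then show ?thesis using m by (auto simp: cycles_free_def)
  qed
  have finA: "finite ?A" by (rule finite_subset[of _ "Pow ?V"]) (use V in auto)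
  have cardA: "card ?A = ?n choose q" by (rule n_subsets[OF V])
  have Apos: "?n choose q > 0" using n by simp
  then have "?A \<noteq> {}" using cardA by (metis card.empty less_irrefl)
  have "?A \<subseteq> ?bad \<union> (?A \<inter> ?good)" using cycle by blast
  then have "card ?A \<le> card (?bad \<union> (?A \<inter> ?good))"
    using finA by (intro card_mono) (auto intro: finite_subset[OF _ finA])
  also have "\<dots> \<le> card ?bad + card (?A \<inter> ?good)" by (rule card_Un_le)
  finally have "4 * card ?A \<le> 5 * card (?A \<inter> ?good)" using bad cardA by linarith
  then have "real (4 * card ?A) \<le> real (5 * card (?A \<inter> ?good))" by (rule of_nat_mono)
  moreover have "measure_pmf.prob (random_vertex_set G q) ?good = card (?A \<inter> ?good) / card ?A"
    unfolding random_vertex_set_def using \<open>?A \<noteq> {}\<close> finA by (rule measure_pmf_of_set)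
  moreover have "real (card ?A) > 0" using cardA Apos by simp
  ultimately show "2 / 3 \<le> measure_pmf.prob (random_vertex_set G q) ?good"
    by (simp add: pos_le_divide_eq)
qed

section \<open>Bounded gaps give polynomial sample complexity\<close>

lemma polynomial_gaps:
  fixes l :: "nat \<Rightarrow> nat"
  assumes l: "strict_mono l" "l 0 \<ge> 3"
    and lim: "limsup (\<lambda>j. ereal (ln (real (l (Suc j))) / ln (real (l j)))) < \<infinity>"
  shows "\<exists>A x0. \<forall>x\<ge>x0. \<exists>j. x \<le> l j \<and> l j \<le> x ^ A"
proof -
  obtain B where B: "limsup (\<lambda>j. ereal (ln (real (l (Suc j))) / ln (real (l j)))) < ereal B"
    using ereal_dense2[OF lim] by auto
  then have "eventually (\<lambda>j. ereal (ln (real (l (Suc j))) / ln (real (l j))) < ereal B) sequentially"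
    by (rule Limsup_lessD)
  then obtain j0 where j0: "\<And>j. j \<ge> j0 \<Longrightarrow> ln (real (l (Suc j))) / ln (real (l j)) < B"
    by (auto simp: eventually_sequentially)
  define A where "A = nat \<lceil>max B 1\<rceil>"
  have A: "B \<le> real A" "A \<ge> 1" by (auto simp: A_def le_nat_iff) linarith+
  have l3: "l j \<ge> 3" for j using l by (meson le_trans strict_mono_less_eq zero_le)
  have step: "l (Suc j) \<le> l j ^ A" if "j \<ge> j0" for j
  proof -
    have "ln (real (l j)) > 0" using l3[of j] by simp
    then have "ln (real (l (Suc j))) \<le> B * ln (real (l j))"
      using j0[OF that] by (simp add: pos_divide_less_eq)
    also have "\<dots> \<le> A * ln (real (l j))" using A(1) l3[of j] by (intro mult_right_mono) auto
    also have "\<dots> = ln (real (l j) ^ A)" using l3[of j] by (simp add: ln_realpow)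
    finally have "real (l (Suc j)) \<le> real (l j) ^ A"
      using l3[of j] l3[of "Suc j"] by (subst (asm) ln_le_cancel_iff) auto
    then have "real (l (Suc j)) \<le> real (l j ^ A)" by simp
    then show ?thesis by (simp only: of_nat_le_iff)
  qed
  have "\<exists>j. x \<le> l j \<and> l j \<le> x ^ A" if x: "x \<ge> l j0" for x
  proof -
    \<comment> \<open>The preceding element is below \<open>x\<close>, so one polynomial gap leads
      to at most \<open>x ^ A\<close>. The gap bound only holds from \<open>j0\<close> on; smaller
      indices are harmless because \<open>x\<close> is at least \<open>l j0\<close>.\<close>
    define j where "j = (LEAST j. x \<le> l j)"
    have "x \<le> l x" using l(1) by (rule strict_mono_imp_increasing)
    then have xj: "x \<le> l j" unfolding j_def by (rule LeastI)
    show ?thesis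
    proof (cases "j \<le> j0")
      case True
      then have "l j \<le> x" using l(1) x by (meson le_trans strict_mono_less_eq)
      also have "x \<le> x ^ A" using A(2) by (intro self_le_power) (use x l3[of j0] in auto)
      finally show ?thesis using xj by blast
    next
      case False
      then obtain i where i: "j = Suc i" "i \<ge> j0" by (cases j) auto
      have "\<not> x \<le> l i" using not_less_Least[of i "\<lambda>j. x \<le> l j"] i(1) by (simp add: j_def)
      then have "l i ^ A \<le> x ^ A" by (intro power_mono) auto
      then show ?thesis using step[OF i(2)] xj i(1) by (intro exI[of _ j]) auto
    qed
  qed
  then show ?thesis by blast
qed

text \<open>Everything is bounded by powers of k, which is about 1/eps: \<open>w\<close> by 11840
  k^3 with 11840 = 1280 + 10240 + 320, then \<open>K\<close> by a multiple of k^6, the chosen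
  element of the sequence by (c k^6)^A, and \<open>q\<close> by d k^(18 + 6A).\<close>

lemma poly_if_bounded_gaps:
  fixes l :: "nat \<Rightarrow> nat"
  assumes l: "\<And>j. odd (l j)" and gaps: "\<And>x. x \<ge> x0 \<Longrightarrow> \<exists>j. x \<le> l j \<and> l j \<le> x ^ A"
  shows "poly_sample_complexity (range l)"
proof -
  define c where "c = 27 * (4 * 11840\<^sup>2) + x0"
  define d where "d = 200 * (4 * 11840\<^sup>2) ^ 3 * c ^ A"
  define e where "e = 18 + 6 * A"
  \<comment> \<open>\<open>C\<close> has to serve both as factor and as exponent; the power of 2
    comes from k \<le> 2/eps.\<close>
  define C where "C = real (max (d * 2 ^ e) e)"
  have "ereal_of_enat (sample_complexity (range l) \<epsilon>) \<le> ereal (C * \<epsilon> powr (- C))"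
    if \<epsilon>: "\<epsilon> \<in> {0<..<1}" for \<epsilon>
  proof -
    define k where "k = nat \<lceil>1 / \<epsilon>\<rceil>"
    have kreal: "1 / \<epsilon> \<le> real k" "real k \<le> 2 / \<epsilon>" "k > 0"
    proof -
      have 1: "1 < 1 / \<epsilon>" using \<epsilon> by (simp add: field_simps)
      then show "1 / \<epsilon> \<le> real k" "k > 0" unfolding k_def by linarith+
      have "real k \<le> 1 / \<epsilon> + 1" using 1 unfolding k_def by linarith
      then show "real k \<le> 2 / \<epsilon>" using 1 by simp
    qed
    define a where "a = 1280 * k\<^sup>2"
    define b where "b = 4 * k * (a + 40)"
    define w where "w = a + 2 * b"
    define K where "K = 4 * w\<^sup>2"
    have "w \<le> 11840 * k ^ 3"
    proof -
      have "k\<^sup>2 \<le> k ^ 3" "k \<le> k ^ 3" using kreal(3) by (auto intro: power_increasing self_le_power)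
      moreover have "w = 1280 * k\<^sup>2 + 10240 * k ^ 3 + 320 * k"
        by (simp add: w_def b_def a_def power2_eq_square power3_eq_cube algebra_simps)
      ultimately show ?thesis by linarith
    qed
    then have "w\<^sup>2 \<le> (11840 * k ^ 3)\<^sup>2" by (intro power_mono) auto
    then have K: "K \<le> 4 * 11840\<^sup>2 * k ^ 6"
      by (simp add: K_def power_mult_distrib flip: power_mult)
    let ?x = "27 * K + x0"
    obtain j where j: "?x \<le> l j" "l j \<le> ?x ^ A" using gaps[of ?x] by auto
    define q where "q = 200 * K ^ 3 * l j"
    have "sample_size_suffices (range l) \<epsilon> q"
    proof (rule sample_size_suffices_if[OF _ _ _ kreal(3) a_def b_def w_def K_def _ q_def])
      show "1 / real k \<le> \<epsilon>" using kreal \<epsilon> by (simp add: field_simps)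
      show "27 * K \<le> l j" using j(1) by simp
    qed (use l in auto)
    moreover have "q > 0"
    proof -
      have "w > 0" using kreal(3) by (simp add: w_def a_def)
      then have "K > 0" by (simp add: K_def)
      moreover have "l j > 0" using l[of j] by (cases "l j") auto
      ultimately show ?thesis by (simp add: q_def)
    qed
    ultimately have "sample_complexity (range l) \<epsilon> \<le> enat q"
      unfolding sample_complexity_def by (intro INF_lower) auto
    then have "ereal_of_enat (sample_complexity (range l) \<epsilon>) \<le> ereal_of_enat (enat q)"
      by (simp only: ereal_of_enat_le_iff)
    also have "\<dots> = ereal (real q)" by simp
    also have "real q \<le> C * \<epsilon> powr (- C)"
    proof -
      have "x0 * 1 \<le> x0 * k ^ 6" using kreal(3) by (intro mult_le_mono2) simp
      then have "?x \<le> 27 * (4 * 11840\<^sup>2 * k ^ 6) + x0 * k ^ 6"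
        using mult_le_mono2[OF K, of 27] by linarith
      also have "\<dots> = c * k ^ 6" by (simp add: c_def distrib_right)
      finally have "?x \<le> c * k ^ 6" .
      then have "?x ^ A \<le> (c * k ^ 6) ^ A" by (intro power_mono) auto
      with j(2) have "l j \<le> (c * k ^ 6) ^ A" by (rule order.trans)
      moreover have "K ^ 3 \<le> (4 * 11840\<^sup>2 * k ^ 6) ^ 3" using K by (intro power_mono) auto
      ultimately have "q \<le> 200 * (4 * 11840\<^sup>2 * k ^ 6) ^ 3 * (c * k ^ 6) ^ A"
        unfolding q_def by (intro mult_le_mono) auto
      also have "\<dots> = d * k ^ e"
        unfolding d_def e_def power_mult_distrib power_add by (simp flip: power_mult)
      finally have "real q \<le> real (d * k ^ e)" by (rule of_nat_mono)
      also have "\<dots> = real d * real k ^ e" by simp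
      also have "\<dots> \<le> real d * (2 / \<epsilon>) ^ e"
        using kreal(2) by (intro mult_left_mono power_mono) auto
      also have "\<dots> = real (d * 2 ^ e) * (1 / \<epsilon>) powr real e"
        using \<epsilon> by (simp add: powr_realpow power_divide)
      also have "\<dots> \<le> C * (1 / \<epsilon>) powr C"
      proof (intro mult_mono powr_mono)
        show "real (d * 2 ^ e) \<le> C" "real e \<le> C" unfolding C_def of_nat_le_iff by simp_all
      qed (use \<epsilon> in \<open>auto simp: C_def\<close>)
      also have "(1 / \<epsilon>) powr C = \<epsilon> powr (- C)"
        using \<epsilon> by (simp add: powr_minus powr_divide inverse_eq_divide)
      finally show ?thesis .
    qed
    finally show ?thesis by simp
  qed
  then show ?thesis unfolding poly_sample_complexity_def by blast
qed

theorem theorem3: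
  fixes l :: "nat \<Rightarrow> nat"
  assumes "strict_mono l"
    and "\<And>j. odd (l j)"
    and "l 0 \<ge> 3"
  shows "poly_sample_complexity (range l) \<longleftrightarrow>
    limsup (\<lambda>j. ereal (ln (real (l (Suc j))) / ln (real (l j)))) < \<infinity>"
proof
  assume "poly_sample_complexity (range l)"
  then obtain B where "\<And>j. ln (real (l (Suc j))) / ln (real (l j)) \<le> B"
    using bounded_gaps_if_poly[OF assms] by blast
  then have "limsup (\<lambda>j. ereal (ln (real (l (Suc j))) / ln (real (l j)))) \<le> ereal B"
    by (intro Limsup_bounded always_eventually) auto
  also have "\<dots> < \<infinity>" by simp
  finally show "limsup (\<lambda>j. ereal (ln (real (l (Suc j))) / ln (real (l j)))) < \<infinity>" .
next
  assume "limsup (\<lambda>j. ereal (ln (real (l (Suc j))) / ln (real (l j)))) < \<infinity>"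
  then obtain A x0 where "\<And>x. x \<ge> x0 \<Longrightarrow> \<exists>j. x \<le> l j \<and> l j \<le> x ^ A"
    using polynomial_gaps[OF assms(1,3)] by blast
  with assms(2) show "poly_sample_complexity (range l)" by (rule poly_if_bounded_gaps)
qed

end
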